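(* Let $a<b$, let $\alpha,\beta:[a,b]^2\to(0,1)$, $\gamma=(\gamma_1,\gamma_2)\in[0,1]^2$, $x_a,z_a\in\mathbb{R}$, and let $L\in C^1([a,b]\times\mathbb{R}^3,\mathbb{R})$. Consider the fractional Herglotz problem: determine $x\in C^1([a,b])$ with $x(a)=x_a$ and a real $T\in[a,b]$ that extremize (minimize or maximize) the value $z(T)$, where $z$ is determined by $x$ through $$\dot z(t)=L\left(t,x(t),{}^{C}D_\gamma^{\alpha(\cdot,\cdot),\beta(\cdot,\cdot)}x(t),z(t)\right),\quad t\in[a,b],\qquad z(a)=z_a .$$ Let $x\in C^1([a,b])$, with $x(a)=x_a$, together with $T\in[a,b]$ and the corresponding $z$, be a solution of this problem (i.e. $z(T)$ is an extremum). Write $[x,z](t)=\left(t,x(t),{}^{C}D_\gamma^{\alpha(\cdot,\cdot),\beta(\cdot,\cdot)}x(t),z(t)\right)$ and $$\lambda(t)=\exp\left(-\int_a^t\partial_4L([x,z](\tau))\,d\tau\right),$$ and assume that, for the function $t\mapsto\lambda(t)\partial_3L([x,z](t))$, the functions $${}_TD_t^{\beta(\cdot,\cdot)}\left(\lambda(t)\partial_3L([x,z](t))\right),\quad {}_aD_t^{\beta(\cdot,\cdot)}\left(\lambda(t)\partial_3L([x,z](t))\right),\quad D_{\overline\gamma}^{\beta(\cdot,\cdot),\alpha(\cdot,\cdot)}\left(\lambda(t)\partial_3L([x,z](t))\right)$$ exist and are continuous on $[a,b]$ (each on the part of $[a,b]$ where it is defined: $[T,b]$, $[a,b]$ and $[a,T]$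 respectively). Then $(x,z)$ satisfies $$\partial_2L([x,z](t))\,\lambda(t)+D_{\overline\gamma}^{\beta(\cdot,\cdot),\alpha(\cdot,\cdot)}\left(\lambda(t)\partial_3L([x,z](t))\right)=0\quad\text{on }[a,T]$$ and $$\gamma_2\left({}_aD_t^{\beta(\cdot,\cdot)}\left(\lambda(t)\partial_3L([x,z](t))\right)-{}_TD_t^{\beta(\cdot,\cdot)}\left(\lambda(t)\partial_3L([x,z](t))\right)\right)=0\quad\text{on }[T,b].$$ Moreover, the following transversality conditions hold: $$\left[\gamma_1\,{}_tI_T^{1-\alpha(\cdot,\cdot)}\left(\lambda(t)\partial_3L([x,z](t))\right)-\gamma_2\,{}_TI_t^{1-\beta(\cdot,\cdot)}\left(\lambda(t)\partial_3L([x,z](t))\right)\right]_{t=T}=0,$$ $$\gamma_2\left[{}_TI_t^{1-\beta(\cdot,\cdot)}\left(\lambda(t)\partial_3L([x,z](t))\right)-{}_aI_t^{1-\beta(\cdot,\cdot)}\left(\lambda(t)\partial_3L([x,z](t))\right)\right]_{t=b}=0.$$ If $T<b$, then $L([x,z](T))=0$.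
   Context: $\partial_iL$ denotes the partial derivative of $L$ with respect to its $i$th argument. Fractional operators of variable order. Let $\alpha:[a,b]^2\to(0,1)$ be a function, let $c\le d$ be points of $[a,b]$, and let $y$ be a real function on $[c,d]$ (below, $c$ and $d$ are the fixed lower or upper endpoints, and $\Gamma$ is the Gamma function). Left and right Riemann–Liouville fractional integrals of order $\alpha(\cdot,\cdot)$: $${}_cI_t^{\alpha(\cdot,\cdot)}y(t)=\int_c^t\frac{(t-\tau)^{\alpha(t,\tau)-1}}{\Gamma(\alpha(t,\tau))}y(\tau)\,d\tau,\qquad {}_tI_d^{\alpha(\cdot,\cdot)}y(t)=\int_t^d\frac{(\tau-t)^{\alpha(\tau,t)-1}}{\Gamma(\alpha(\tau,t))}y(\tau)\,d\tau .$$ The symbols ${}_cI_t^{1-\alpha(\cdot,\cdot)}$, ${}_tI_d^{1-\alpha(\cdot,\cdot)}$ mean the same with $\alpha$ replaced by $1-\alpha$. Left and right Riemann–Liouville fractional derivatives: $${}_cD_t^{\alpha(\cdot,\cdot)}y(t)=\frac{d}{dt}\int_c^t\frac{(t-\tau)^{-\alpha(t,\tau)}}{\Gamma(1-\alpha(t,\tau))}y(\tau)\,d\tau,\qquad {}_tD_d^{\alpha(\cdot,\cdot)}y(t)=\frac{d}{dt}\int_t^d\frac{-(\tau-t)^{-\alpha(\tau,t)}}{\Gamma(1-\alpha(\tau,t))}y(\tau)\,d\tau .$$ Left and right Caputo fractional derivatives: $${}^C_cD_t^{\alpha(\cdot,\cdot)}y(t)=\int_c^t\frac{(t-\tau)^{-\alpha(t,\tau)}}{\Gamma(1-\alpha(t,\tau))}y'(\tau)\,d\tau,\qquad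 {}^C_tD_d^{\alpha(\cdot,\cdot)}y(t)=\int_t^d\frac{-(\tau-t)^{-\alpha(\tau,t)}}{\Gamma(1-\alpha(\tau,t))}y'(\tau)\,d\tau .$$ Combined Caputo fractional derivative, for $\gamma=(\gamma_1,\gamma_2)\in[0,1]^2$ and $\alpha,\beta:[a,b]^2\to(0,1)$: $${}^{C}D_\gamma^{\alpha(\cdot,\cdot),\beta(\cdot,\cdot)}x(t)=\gamma_1\,{}^C_aD_t^{\alpha(\cdot,\cdot)}x(t)+\gamma_2\,{}^C_tD_b^{\beta(\cdot,\cdot)}x(t).$$ Dual (combined Riemann–Liouville) derivative, with $\overline\gamma=(\gamma_2,\gamma_1)$ and $T\in[a,b]$ the final time of the problem: $$D_{\overline\gamma}^{\beta(\cdot,\cdot),\alpha(\cdot,\cdot)}=\gamma_2\,{}_aD_t^{\beta(\cdot,\cdot)}+\gamma_1\,{}_tD_T^{\alpha(\cdot,\cdot)}.$$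
   Formalization: Adds T>a; α, β jointly Borel measurable; and, for every C¹ function, the left (order α) and right (order β) Caputo derivatives exist and are continuous on [a,b] (true for continuous orders). False otherwise: L=e^x, T=a. The second equation is asserted only when T<b. *)

theory Defs
  imports "HOL-Analysis.Analysis"
begin

text \<open>Continuously differentiable functions on \<open>[a,b]\<close>, with one-sided derivatives at the end
  points (the library notion \<open>C1_differentiable_on\<close> uses two-sided derivatives).\<close>

definition C1_on :: "real \<Rightarrow> real \<Rightarrow> (real \<Rightarrow> real) \<Rightarrow> bool" where
  "C1_on a b y \<longleftrightarrow>
     (\<exists>y'. (\<forall>t\<in>{a..b}. (y has_real_derivative y' t) (at t within {a..b})) \<and>
           continuous_on {a..b} y')"

definition C1_lagrangian :: "real \<Rightarrow> real \<Rightarrow> (real \<times> real \<times> real \<times> real \<Rightarrow> real) \<Rightarrow> bool" where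
  "C1_lagrangian a b L \<longleftrightarrow>
     (\<exists>L'. (\<forall>p\<in>{a..b} \<times> UNIV. (L has_derivative blinfun_apply (L' p)) (at p within {a..b} \<times> UNIV)) \<and>
           continuous_on ({a..b} \<times> UNIV) L')"

text \<open>Partial derivatives with respect to the second, third and fourth argument.\<close>

definition partial2 :: "(real \<times> real \<times> real \<times> real \<Rightarrow> real) \<Rightarrow> real \<times> real \<times> real \<times> real \<Rightarrow> real" where
  "partial2 L = (\<lambda>(t, x, v, z). deriv (\<lambda>s. L (t, s, v, z)) x)"

definition partial3 :: "(real \<times> real \<times> real \<times> real \<Rightarrow> real) \<Rightarrow> real \<times> real \<times> real \<times> real \<Rightarrow> real" where
  "partial3 L = (\<lambda>(t, x, v, z). deriv (\<lambda>s. L (t, x, s, z)) v)"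

definition partial4 :: "(real \<times> real \<times> real \<times> real \<Rightarrow> real) \<Rightarrow> real \<times> real \<times> real \<times> real \<Rightarrow> real" where
  "partial4 L = (\<lambda>(t, x, v, z). deriv (\<lambda>s. L (t, x, v, s)) z)"

text \<open>A variable order with values in \<open>(0,1)\<close>. Joint measurability is what makes the (double)
  integrals over the fractional kernels meaningful.\<close>

definition variable_order :: "real \<Rightarrow> real \<Rightarrow> (real \<Rightarrow> real \<Rightarrow> real) \<Rightarrow> bool" where
  "variable_order a b \<alpha> \<longleftrightarrow>
     (\<forall>s\<in>{a..b}. \<forall>t\<in>{a..b}. 0 < \<alpha> s t \<and> \<alpha> s t < 1) \<and>
     (\<lambda>(s, t). \<alpha> s t) \<in> borel_measurable (restrict_space borel ({a..b} \<times> {a..b}))"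

text \<open>Riemann--Liouville integrals; the left one has lower end point \<open>c\<close>, the right one upper end
  point \<open>d\<close>. In the right operators the arguments of the order are swapped.\<close>

definition left_RL_integral :: "(real \<Rightarrow> real \<Rightarrow> real) \<Rightarrow> real \<Rightarrow> (real \<Rightarrow> real) \<Rightarrow> real \<Rightarrow> real" where
  "left_RL_integral \<alpha> c y t =
     (LBINT \<tau>:{c..t}. (t - \<tau>) powr (\<alpha> t \<tau> - 1) / Gamma (\<alpha> t \<tau>) * y \<tau>)"

definition right_RL_integral :: "(real \<Rightarrow> real \<Rightarrow> real) \<Rightarrow> real \<Rightarrow> (real \<Rightarrow> real) \<Rightarrow> real \<Rightarrow> real" where
  "right_RL_integral \<alpha> d y t =
     (LBINT \<tau>:{t..d}. (\<tau> - t) powr (\<alpha> \<tau> t - 1) / Gamma (\<alpha> \<tau> t) * y \<tau>)"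

text \<open>The kernel shared by all derivative operators below; the left operators use
  \<open>frac_kernel \<alpha> t \<tau>\<close>, the right ones \<open>- frac_kernel \<alpha> \<tau> t\<close>.\<close>

definition frac_kernel :: "(real \<Rightarrow> real \<Rightarrow> real) \<Rightarrow> real \<Rightarrow> real \<Rightarrow> real" where
  "frac_kernel \<alpha> s r = (s - r) powr (- \<alpha> s r) / Gamma (1 - \<alpha> s r)"

text \<open>Riemann--Liouville derivatives on an interval \<open>[c,d]\<close>. The outer derivative is taken within
  \<open>[c,d]\<close>, hence one-sided at \<open>c\<close> and \<open>d\<close>. As \<open>vector_derivative\<close> and the integral are total,
  existence is a separate predicate, comprising integrability of the integrand and
  differentiability of the integral.\<close>

definition left_RL_deriv ::
  "(real \<Rightarrow> real \<Rightarrow> real) \<Rightarrow> real \<Rightarrow> real \<Rightarrow> (real \<Rightarrow> real) \<Rightarrow> real \<Rightarrow> real" where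
  "left_RL_deriv \<alpha> c d y t =
     vector_derivative (\<lambda>s. LBINT \<tau>:{c..s}. frac_kernel \<alpha> s \<tau> * y \<tau>) (at t within {c..d})"

definition left_RL_deriv_exists ::
  "(real \<Rightarrow> real \<Rightarrow> real) \<Rightarrow> real \<Rightarrow> real \<Rightarrow> (real \<Rightarrow> real) \<Rightarrow> bool" where
  "left_RL_deriv_exists \<alpha> c d y \<longleftrightarrow>
     (\<forall>t\<in>{c..d}. set_integrable lborel {c..t} (\<lambda>\<tau>. frac_kernel \<alpha> t \<tau> * y \<tau>)) \<and>
     (\<forall>t\<in>{c..d}. (\<lambda>s. LBINT \<tau>:{c..s}. frac_kernel \<alpha> s \<tau> * y \<tau>) differentiable (at t within {c..d}))"

definition right_RL_deriv ::
  "(real \<Rightarrow> real \<Rightarrow> real) \<Rightarrow> real \<Rightarrow> real \<Rightarrow> (real \<Rightarrow> real) \<Rightarrow> real \<Rightarrow> real" where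
  "right_RL_deriv \<alpha> c d y t =
     vector_derivative (\<lambda>s. LBINT \<tau>:{s..d}. - frac_kernel \<alpha> \<tau> s * y \<tau>) (at t within {c..d})"

definition right_RL_deriv_exists ::
  "(real \<Rightarrow> real \<Rightarrow> real) \<Rightarrow> real \<Rightarrow> real \<Rightarrow> (real \<Rightarrow> real) \<Rightarrow> bool" where
  "right_RL_deriv_exists \<alpha> c d y \<longleftrightarrow>
     (\<forall>t\<in>{c..d}. set_integrable lborel {t..d} (\<lambda>\<tau>. - frac_kernel \<alpha> \<tau> t * y \<tau>)) \<and>
     (\<forall>t\<in>{c..d}. (\<lambda>s. LBINT \<tau>:{s..d}. - frac_kernel \<alpha> \<tau> s * y \<tau>) differentiable (at t within {c..d}))"

definition left_Caputo ::
  "(real \<Rightarrow> real \<Rightarrow> real) \<Rightarrow> real \<Rightarrow> real \<Rightarrow> (real \<Rightarrow> real) \<Rightarrow> real \<Rightarrow> real" where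
  "left_Caputo \<alpha> c d y t =
     (LBINT \<tau>:{c..t}. frac_kernel \<alpha> t \<tau> * vector_derivative y (at \<tau> within {c..d}))"

definition left_Caputo_exists ::
  "(real \<Rightarrow> real \<Rightarrow> real) \<Rightarrow> real \<Rightarrow> real \<Rightarrow> (real \<Rightarrow> real) \<Rightarrow> bool" where
  "left_Caputo_exists \<alpha> c d y \<longleftrightarrow>
     (\<forall>t\<in>{c..d}. set_integrable lborel {c..t}
        (\<lambda>\<tau>. frac_kernel \<alpha> t \<tau> * vector_derivative y (at \<tau> within {c..d})))"

definition right_Caputo ::
  "(real \<Rightarrow> real \<Rightarrow> real) \<Rightarrow> real \<Rightarrow> real \<Rightarrow> (real \<Rightarrow> real) \<Rightarrow> real \<Rightarrow> real" where
  "right_Caputo \<alpha> c d y t =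
     (LBINT \<tau>:{t..d}. - frac_kernel \<alpha> \<tau> t * vector_derivative y (at \<tau> within {c..d}))"

definition right_Caputo_exists ::
  "(real \<Rightarrow> real \<Rightarrow> real) \<Rightarrow> real \<Rightarrow> real \<Rightarrow> (real \<Rightarrow> real) \<Rightarrow> bool" where
  "right_Caputo_exists \<alpha> c d y \<longleftrightarrow>
     (\<forall>t\<in>{c..d}. set_integrable lborel {t..d}
        (\<lambda>\<tau>. - frac_kernel \<alpha> \<tau> t * vector_derivative y (at \<tau> within {c..d})))"

definition combined_Caputo ::
  "real \<Rightarrow> real \<Rightarrow> (real \<Rightarrow> real \<Rightarrow> real) \<Rightarrow> (real \<Rightarrow> real \<Rightarrow> real) \<Rightarrow> real \<Rightarrow> real \<Rightarrow>
     (real \<Rightarrow> real) \<Rightarrow> real \<Rightarrow> real" where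
  "combined_Caputo a b \<alpha> \<beta> \<gamma>1 \<gamma>2 x t = \<gamma>1 * left_Caputo \<alpha> a b x t + \<gamma>2 * right_Caputo \<beta> a b x t"

text \<open>The Caputo operators are meaningful, with continuous values, on all of \<open>C\<^sup>1([a,b])\<close>, so that
  every \<open>C\<^sup>1\<close> function is a legitimate candidate in the Herglotz problem. This holds, for instance,
  whenever the orders are continuous on the square \<open>[a,b]\<^sup>2\<close>; for completely arbitrary orders
  the integrals need not exist.\<close>

definition Caputo_well_posed ::
  "real \<Rightarrow> real \<Rightarrow> (real \<Rightarrow> real \<Rightarrow> real) \<Rightarrow> (real \<Rightarrow> real \<Rightarrow> real) \<Rightarrow> bool" where
  "Caputo_well_posed a b \<alpha> \<beta> \<longleftrightarrow>
     (\<forall>y. C1_on a b y \<longrightarrow>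
        left_Caputo_exists \<alpha> a b y \<and> continuous_on {a..b} (left_Caputo \<alpha> a b y) \<and>
        right_Caputo_exists \<beta> a b y \<and> continuous_on {a..b} (right_Caputo \<beta> a b y))"

text \<open>The dual operator lives on \<open>[a,T]\<close>; its left part is the restriction of the left derivative
  on \<open>[a,b]\<close>.\<close>

definition dual_RL_deriv ::
  "real \<Rightarrow> real \<Rightarrow> real \<Rightarrow> (real \<Rightarrow> real \<Rightarrow> real) \<Rightarrow> (real \<Rightarrow> real \<Rightarrow> real) \<Rightarrow> real \<Rightarrow> real \<Rightarrow>
     (real \<Rightarrow> real) \<Rightarrow> real \<Rightarrow> real" where
  "dual_RL_deriv a b T \<alpha> \<beta> \<gamma>1 \<gamma>2 y t =
     \<gamma>2 * left_RL_deriv \<beta> a b y t + \<gamma>1 * right_RL_deriv \<alpha> a T y t"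

definition herglotz_arg ::
  "real \<Rightarrow> real \<Rightarrow> (real \<Rightarrow> real \<Rightarrow> real) \<Rightarrow> (real \<Rightarrow> real \<Rightarrow> real) \<Rightarrow> real \<Rightarrow> real \<Rightarrow>
     (real \<Rightarrow> real) \<Rightarrow> (real \<Rightarrow> real) \<Rightarrow> real \<Rightarrow> real \<times> real \<times> real \<times> real" where
  "herglotz_arg a b \<alpha> \<beta> \<gamma>1 \<gamma>2 x z t = (t, x t, combined_Caputo a b \<alpha> \<beta> \<gamma>1 \<gamma>2 x t, z t)"

text \<open>Admissible triples: \<open>z\<close> is a (classical) solution on \<open>[a,b]\<close> of the initial value problem
  determined by \<open>x\<close>.\<close>

definition herglotz_admissible ::
  "(real \<times> real \<times> real \<times> real \<Rightarrow> real) \<Rightarrow> real \<Rightarrow> real \<Rightarrow>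
     (real \<Rightarrow> real \<Rightarrow> real) \<Rightarrow> (real \<Rightarrow> real \<Rightarrow> real) \<Rightarrow> real \<Rightarrow> real \<Rightarrow> real \<Rightarrow> real \<Rightarrow>
     (real \<Rightarrow> real) \<Rightarrow> (real \<Rightarrow> real) \<Rightarrow> real \<Rightarrow> bool" where
  "herglotz_admissible L a b \<alpha> \<beta> \<gamma>1 \<gamma>2 xa za x z T \<longleftrightarrow>
     C1_on a b x \<and> x a = xa \<and> T \<in> {a..b} \<and> z a = za \<and>
     (\<forall>t\<in>{a..b}. (z has_real_derivative L (herglotz_arg a b \<alpha> \<beta> \<gamma>1 \<gamma>2 x z t)) (at t within {a..b}))"

definition herglotz_solution ::
  "(real \<times> real \<times> real \<times> real \<Rightarrow> real) \<Rightarrow> real \<Rightarrow> real \<Rightarrow>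
     (real \<Rightarrow> real \<Rightarrow> real) \<Rightarrow> (real \<Rightarrow> real \<Rightarrow> real) \<Rightarrow> real \<Rightarrow> real \<Rightarrow> real \<Rightarrow> real \<Rightarrow>
     (real \<Rightarrow> real) \<Rightarrow> (real \<Rightarrow> real) \<Rightarrow> real \<Rightarrow> bool" where
  "herglotz_solution L a b \<alpha> \<beta> \<gamma>1 \<gamma>2 xa za x z T \<longleftrightarrow>
     herglotz_admissible L a b \<alpha> \<beta> \<gamma>1 \<gamma>2 xa za x z T \<and>
     ((\<forall>y w S. herglotz_admissible L a b \<alpha> \<beta> \<gamma>1 \<gamma>2 xa za y w S \<longrightarrow> z T \<le> w S) \<or>
      (\<forall>y w S. herglotz_admissible L a b \<alpha> \<beta> \<gamma>1 \<gamma>2 xa za y w S \<longrightarrow> w S \<le> z T))"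

end

theory Submission
  imports Defs
begin

text \<open>The first variation of \<open>z(T)\<close> in direction \<open>h\<close> with \<open>h(a) = 0\<close> is, up to the factor \<open>1 / lam T\<close>,
  the integral over \<open>[a,T]\<close> of \<open>lam * (partial2 L * h + partial3 L * D h)\<close>, with \<open>D\<close> the combined Caputo
  derivative; it vanishes at an extremum. Fubini's theorem moves the fractional kernels from
  \<open>h'\<close> to \<open>g = lam * partial3 L\<close>, so that the variation becomes the integral over \<open>[a,b]\<close> of \<open>M * h'\<close>.
  Here \<open>M = \<Lambda> + \<gamma>1 K - \<gamma>2 H\<close>, where \<open>\<Lambda>\<close>, \<open>K\<close>, \<open>H\<close> are the integrals of \<open>lam * partial2 L\<close> over \<open>[s,T]\<close>, of
  the \<open>\<alpha>\<close>-kernel times \<open>g\<close> over \<open>[s,T]\<close>, and of the \<open>\<beta>\<close>-kernel times \<open>g\<close> over \<open>[a, min s T]\<close>. This \<open>M\<close>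
  is continuous on \<open>[a,b]\<close>, also at \<open>T\<close>, so \<open>h' = M\<close> is an admissible choice and \<open>M = 0\<close>. Both
  Euler--Lagrange equations are the derivative of \<open>M = 0\<close>, the transversality condition at \<open>b\<close> is
  \<open>M b = 0\<close>, and \<open>L([x,z](T)) = 0\<close> is Fermat's rule for \<open>z\<close> at an interior \<open>T\<close>.\<close>

subsection \<open>Functions on compact intervals\<close>

lemma continuous_on_Icc_bounded:
  fixes f :: "real \<Rightarrow> 'a::real_normed_vector"
  assumes "continuous_on {a..b} f"
  obtains C where "0 < C" "\<And>t. t \<in> {a..b} \<Longrightarrow> norm (f t) \<le> C"
proof -
  have "bounded (f ` {a..b})"
    using assms by (intro compact_imp_bounded compact_continuous_image) auto
  then show thesis using that unfolding bounded_pos by blast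
qed

lemma continuous_on_Icc_join:
  fixes f :: "real \<Rightarrow> 'a::topological_space"
  assumes "continuous_on {a..T} f" "continuous_on {T..b} f" "a \<le> T" "T \<le> b"
  shows "continuous_on {a..b} f"
  using continuous_on_closed_Un[OF _ _ assms(1,2)] ivl_disj_un_two_touch(4)[OF assms(3,4)] by simp

lemma LBINT_eq_integral:
  fixes f :: "real \<Rightarrow> real"
  assumes "continuous_on {a..b} f"
  shows "(LBINT t:{a..b}. f t) = integral {a..b} f"
  using assms by (intro set_borel_integral_eq_integral borel_integrable_atLeastAtMost')

lemma LBINT_singleton: "(LBINT t:{c..c}. f t) = 0" for f :: "real \<Rightarrow> real"
  unfolding set_lebesgue_integral_def
  by (rule integral_eq_zero_AE, rule AE_mp[OF AE_lborel_singleton[of c]]) auto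

lemma LBINT_empty: "(LBINT t:{}. f t) = 0" for f :: "real \<Rightarrow> real"
  by (simp add: set_lebesgue_integral_def)

text \<open>Since \<open>c < d\<close>, the derivative within the interval is unique even at an end
  point, where it is one-sided. This turns an identity on a closed interval into an equation between
  derivatives.\<close>

lemma derivative_zero_on_Icc:
  fixes f :: "real \<Rightarrow> real"
  assumes "c < d" "t \<in> {c..d}" "(f has_real_derivative D) (at t within {c..d})"
    and "\<And>s. s \<in> {c..d} \<Longrightarrow> f s = 0"
  shows "D = 0"
proof -
  have "((\<lambda>_. 0) has_vector_derivative D) (at t within {c..d})"
    using assms(2-) by (intro has_vector_derivative_transform[of t _ "\<lambda>_. 0" f])
      (auto simp: has_real_derivative_iff_has_vector_derivative)
  then show ?thesis
    using assms(1,2) vector_derivative_unique_within_closed_interval[of c d t "\<lambda>_. 0" D 0] by simp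
qed

subsection \<open>The fractional kernels\<close>

text \<open>The order is known to be measurable only on the square, hence the indicator. Division by
  \<open>Gamma\<close> becomes multiplication by \<open>rGamma\<close>, which is continuous on the
  whole line, whereas \<open>Gamma\<close> has poles.\<close>

lemma frac_kernel_measurable:
  assumes "variable_order a b \<alpha>"
  shows "(\<lambda>(s, r). indicator ({a..b} \<times> {a..b}) (s, r) * frac_kernel \<alpha> s r)
           \<in> borel_measurable (lborel \<Otimes>\<^sub>M lborel)"
proof -
  let ?S = "{a..b} \<times> {a..b}"
  have al: "(\<lambda>p. \<alpha> (fst p) (snd p)) \<in> borel_measurable (restrict_space borel ?S)"
    using assms by (simp add: variable_order_def case_prod_unfold)
  have [measurable]: "(rGamma :: real \<Rightarrow> real) \<in> borel_measurable borel"
    by (intro borel_measurable_continuous_onI continuous_intros)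
  have [measurable]: "(\<lambda>p::real\<times>real. fst p - snd p) \<in> borel_measurable (restrict_space borel ?S)"
    by (intro measurable_restrict_space1 borel_measurable_continuous_onI continuous_intros)
  have "(\<lambda>p. (fst p - snd p) powr (- \<alpha> (fst p) (snd p)) * rGamma (1 - \<alpha> (fst p) (snd p)))
     \<in> borel_measurable (restrict_space borel ?S)"
    using al by measurable
  moreover have "?S \<in> sets (borel :: (real \<times> real) measure)"
    by (intro borel_closed closed_Times) auto
  ultimately have "(\<lambda>p. indicator ?S p *\<^sub>R
      ((fst p - snd p) powr (- \<alpha> (fst p) (snd p)) * rGamma (1 - \<alpha> (fst p) (snd p))))
     \<in> borel_measurable borel"
    by (subst (asm) borel_measurable_restrict_space_iff) auto
  then have "(\<lambda>(s, r). indicator ?S (s, r) * frac_kernel \<alpha> s r) \<in> borel_measurable borel"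
    by (simp add: case_prod_unfold frac_kernel_def rGamma_inverse_Gamma divide_inverse)
  then show ?thesis
    by (simp add: lborel_prod)
qed

lemma frac_kernel_nonneg:
  assumes "variable_order a b \<alpha>" "s \<in> {a..b}" "r \<in> {a..b}"
  shows "0 \<le> frac_kernel \<alpha> s r"
proof -
  have "0 < Gamma (1 - \<alpha> s r)"
    using assms by (intro Gamma_real_pos) (auto simp: variable_order_def)
  then show ?thesis by (simp add: frac_kernel_def)
qed

section \<open>Fubini's theorem for the fractional kernels\<close>

text \<open>A nonnegative kernel whose sections over a compact interval have uniformly bounded mass
  is integrable on the plane. It stays integrable after multiplication by bounded measurable
  functions, so the order of integration may be exchanged.\<close>

lemma Fubini_bounded_kernel:
  fixes \<kappa> :: "real \<Rightarrow> real \<Rightarrow> real"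
  assumes \<kappa>: "(\<lambda>(t, s). \<kappa> t s) \<in> borel_measurable (lborel \<Otimes>\<^sub>M lborel)"
    and nonneg: "\<And>t s. 0 \<le> \<kappa> t s"
    and outside: "\<And>t s. t \<notin> {a..b} \<Longrightarrow> \<kappa> t s = 0"
    and int: "\<And>t. t \<in> {a..b} \<Longrightarrow> integrable lborel (\<kappa> t)"
    and bound: "\<And>t. t \<in> {a..b} \<Longrightarrow> (\<integral>s. \<kappa> t s \<partial>lborel) \<le> C"
    and G: "G \<in> borel_measurable borel" "\<And>t. \<bar>G t\<bar> \<le> A"
    and F: "F \<in> borel_measurable borel" "\<And>s. \<bar>F s\<bar> \<le> B"
  shows "(\<integral>t. G t * (\<integral>s. \<kappa> t s * F s \<partial>lborel) \<partial>lborel) =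
         (\<integral>s. F s * (\<integral>t. \<kappa> t s * G t \<partial>lborel) \<partial>lborel)"
proof -
  note [measurable] = \<kappa> G(1) F(1)
  have A0: "0 \<le> A" using G(2)[of 0] by simp
  have B0: "0 \<le> B" using F(2)[of 0] by simp
  have ki: "integrable lborel (\<kappa> t)" for t
  proof (cases "t \<in> {a..b}")
    case False
    then have "\<kappa> t = (\<lambda>_. 0)" using outside by auto
    then show ?thesis by simp
  qed (rule int)
  have kl: "0 \<le> (\<integral>s. \<kappa> t s \<partial>lborel)" for t by (intro Bochner_Integration.integral_nonneg nonneg)
  have kb: "(\<integral>s. \<kappa> t s \<partial>lborel) \<le> indicator {a..b} t * \<bar>C\<bar>" for t
    using bound[of t] outside[of t] by (cases "t \<in> {a..b}") (auto simp: indicator_def)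
  have "integrable (lborel \<Otimes>\<^sub>M lborel) (\<lambda>(t, s). \<kappa> t s)"
  proof (rule lborel_pair.Fubini_integrable)
    show "AE t in lborel. integrable lborel (\<lambda>s. (case (t, s) of (t, s) \<Rightarrow> \<kappa> t s))"
      using ki by simp
    show "integrable lborel (\<lambda>t. \<integral>s. norm (case (t, s) of (t, s) \<Rightarrow> \<kappa> t s) \<partial>lborel)"
    proof (rule Bochner_Integration.integrable_bound)
      show "integrable lborel (\<lambda>t. indicator {a..b} t * \<bar>C\<bar> :: real)"
      by (auto simp: emeasure_lborel_Icc_eq intro!: integrable_real_indicator)
    qed (use kb kl nonneg in \<open>auto\<close>)
  qed fact
  then have "integrable (lborel \<Otimes>\<^sub>M lborel) (\<lambda>p. (A * B) * (case p of (t, s) \<Rightarrow> \<kappa> t s))"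
    by simp
  then have "integrable (lborel \<Otimes>\<^sub>M lborel) (\<lambda>(t, s). G t * (\<kappa> t s * F s))"
  proof (rule Bochner_Integration.integrable_bound)
    show "AE p in lborel \<Otimes>\<^sub>M lborel. norm (case p of (t, s) \<Rightarrow> G t * (\<kappa> t s * F s))
            \<le> norm ((A * B) * (case p of (t, s) \<Rightarrow> \<kappa> t s))"
    proof (rule AE_I2, clarify)
      fix t s
      have "\<bar>G t\<bar> * (\<bar>\<kappa> t s\<bar> * \<bar>F s\<bar>) \<le> A * (\<bar>\<kappa> t s\<bar> * B)"
        using G(2) F(2) A0 B0 by (intro mult_mono) auto
      then show "norm (G t * (\<kappa> t s * F s)) \<le> norm ((A * B) * \<kappa> t s)"
        using A0 B0 by (simp add: abs_mult mult_ac)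
    qed
  qed measurable
  from lborel_pair.Fubini_integral[OF this, symmetric]
  show ?thesis by (simp add: mult_ac flip: integral_mult_right_zero)
qed

text \<open>Testing well-posedness with \<open>y t = t\<close> bounds the kernels themselves.\<close>

lemma frac_kernel_integral_bounded:
  assumes ab: "a < b" and wp: "Caputo_well_posed a b \<alpha> \<beta>"
  obtains C where
    "\<And>t. t \<in> {a..b} \<Longrightarrow> set_integrable lborel {a..t} (frac_kernel \<alpha> t)"
    "\<And>t. t \<in> {a..b} \<Longrightarrow> set_integrable lborel {t..b} (\<lambda>s. frac_kernel \<beta> s t)"
    "\<And>t. t \<in> {a..b} \<Longrightarrow> \<bar>LBINT s:{a..t}. frac_kernel \<alpha> t s\<bar> \<le> C"
    "\<And>t. t \<in> {a..b} \<Longrightarrow> \<bar>LBINT s:{t..b}. frac_kernel \<beta> s t\<bar> \<le> C"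
proof -
  let ?D = "\<lambda>s. vector_derivative (\<lambda>t. t) (at s within {a..b})"
  have "C1_on a b (\<lambda>t. t)" unfolding C1_on_def
    by (intro exI[of _ "\<lambda>_. 1"]) (auto intro!: derivative_eq_intros)
  with wp have wp': "left_Caputo_exists \<alpha> a b (\<lambda>t. t)" "continuous_on {a..b} (left_Caputo \<alpha> a b (\<lambda>t. t))"
    "right_Caputo_exists \<beta> a b (\<lambda>t. t)" "continuous_on {a..b} (right_Caputo \<beta> a b (\<lambda>t. t))"
    unfolding Caputo_well_posed_def by auto
  have D: "?D s = 1" if "s \<in> {a..b}" for s
    using ab that by (intro vector_derivative_within_closed_interval) (auto intro: derivative_intros)
  have l: "set_integrable lborel {a..t} (frac_kernel \<alpha> t)"
    "left_Caputo \<alpha> a b (\<lambda>t. t) t = (LBINT s:{a..t}. frac_kernel \<alpha> t s)" if t: "t \<in> {a..b}" for t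
  proof -
    have "set_integrable lborel {a..t} (\<lambda>s. frac_kernel \<alpha> t s * ?D s)"
      using wp'(1) t unfolding left_Caputo_exists_def by blast
    also have "?this \<longleftrightarrow> set_integrable lborel {a..t} (frac_kernel \<alpha> t)"
      using t D by (intro set_integrable_cong) auto
    finally show "set_integrable lborel {a..t} (frac_kernel \<alpha> t)" .
    show "left_Caputo \<alpha> a b (\<lambda>t. t) t = (LBINT s:{a..t}. frac_kernel \<alpha> t s)"
      unfolding left_Caputo_def using t D by (intro set_lebesgue_integral_cong) auto
  qed
  have r: "set_integrable lborel {t..b} (\<lambda>s. frac_kernel \<beta> s t)"
    "right_Caputo \<beta> a b (\<lambda>t. t) t = - (LBINT s:{t..b}. frac_kernel \<beta> s t)" if t: "t \<in> {a..b}" for t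
  proof -
    have "set_integrable lborel {t..b} (\<lambda>s. - (- frac_kernel \<beta> s t * ?D s))"
      using wp'(3) t unfolding right_Caputo_exists_def
      by (auto dest!: bspec simp: set_integrable_def)
    also have "?this \<longleftrightarrow> set_integrable lborel {t..b} (\<lambda>s. frac_kernel \<beta> s t)"
      using t D by (intro set_integrable_cong) auto
    finally show "set_integrable lborel {t..b} (\<lambda>s. frac_kernel \<beta> s t)" .
    have "right_Caputo \<beta> a b (\<lambda>t. t) t = (LBINT s:{t..b}. - frac_kernel \<beta> s t)"
      unfolding right_Caputo_def using t D by (intro set_lebesgue_integral_cong) auto
    then show "right_Caputo \<beta> a b (\<lambda>t. t) t = - (LBINT s:{t..b}. frac_kernel \<beta> s t)"
      by (simp add: set_lebesgue_integral_def)
  qed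
  obtain C1 where C1: "\<And>t. t \<in> {a..b} \<Longrightarrow> \<bar>left_Caputo \<alpha> a b (\<lambda>t. t) t\<bar> \<le> C1"
    using continuous_on_Icc_bounded[OF wp'(2)] unfolding real_norm_def by blast
  obtain C2 where C2: "\<And>t. t \<in> {a..b} \<Longrightarrow> \<bar>right_Caputo \<beta> a b (\<lambda>t. t) t\<bar> \<le> C2"
    using continuous_on_Icc_bounded[OF wp'(4)] unfolding real_norm_def by blast
  show thesis
    by (rule that[of "max C1 C2"]; (rule l(1) r(1); assumption)?)
      (use C1 C2 l(2) r(2) in \<open>force simp: le_max_iff_disj\<close>)+
qed

text \<open>The continuous functions are extended by zero off \<open>[a,b]\<close>, which makes them
  bounded and Borel measurable on the whole line, and the kernel is cut off outside
  \<open>E\<close>. The left and the right operator then differ only in the choice of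
  \<open>E\<close>.\<close>

lemma kernel_integral_swap:
  fixes k :: "real \<Rightarrow> real \<Rightarrow> real"
  assumes k: "(\<lambda>(t, s). indicator ({a..b} \<times> {a..b}) (t, s) * k t s) \<in> borel_measurable (lborel \<Otimes>\<^sub>M lborel)"
    and nonneg: "\<And>t s. t \<in> {a..b} \<Longrightarrow> s \<in> {a..b} \<Longrightarrow> 0 \<le> k t s"
    and E: "E \<in> sets (lborel \<Otimes>\<^sub>M lborel)" "E \<subseteq> {a..b} \<times> {a..b}"
    and int: "\<And>t. t \<in> {a..b} \<Longrightarrow> set_integrable lborel {s. (t, s) \<in> E} (k t)"
    and bound: "\<And>t. t \<in> {a..b} \<Longrightarrow> (LBINT s:{s. (t, s) \<in> E}. k t s) \<le> C"
    and g: "continuous_on {a..b} g" and f: "continuous_on {a..b} f"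
  shows "(LBINT t:{a..b}. g t * (LBINT s:{s. (t, s) \<in> E}. k t s * f s)) =
         (LBINT s:{a..b}. f s * (LBINT t:{t. (t, s) \<in> E}. k t s * g t))"
proof -
  have ext: "(\<lambda>t. indicator {a..b} t * u t) \<in> borel_measurable borel \<and>
      (\<exists>A. \<forall>t. \<bar>indicator {a..b} t * u t\<bar> \<le> A)"
    if u: "continuous_on {a..b} u" for u :: "real \<Rightarrow> real"
  proof
    show "(\<lambda>t. indicator {a..b} t * u t) \<in> borel_measurable borel"
      using borel_measurable_continuous_on_indicator[OF _ u] by simp
    obtain A where "\<And>t. t \<in> {a..b} \<Longrightarrow> \<bar>u t\<bar> \<le> A"
      using continuous_on_Icc_bounded[OF u] unfolding real_norm_def by blast
    then have "\<bar>indicator {a..b} t * u t\<bar> \<le> \<bar>A\<bar>" for t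
      by (cases "t \<in> {a..b}") fastforce+
    then show "\<exists>A. \<forall>t. \<bar>indicator {a..b} t * u t\<bar> \<le> A" by blast
  qed
  obtain A where A: "\<And>t. \<bar>indicator {a..b} t * g t\<bar> \<le> A" using ext[OF g] by auto
  obtain B where B: "\<And>t. \<bar>indicator {a..b} t * f t\<bar> \<le> B" using ext[OF f] by auto
  define \<kappa> where "\<kappa> t s = indicator E (t, s) * k t s" for t s
  have E': "indicator E (t, s) = indicator {s. (t, s) \<in> E} s" for t s
    by (auto simp: indicator_def)
  have E'': "indicator E (t, s) = indicator {t. (t, s) \<in> E} t" for t s
    by (auto simp: indicator_def)
  have "(\<integral>t. (indicator {a..b} t * g t) * (\<integral>s. \<kappa> t s * (indicator {a..b} s * f s) \<partial>lborel) \<partial>lborel) =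
        (\<integral>s. (indicator {a..b} s * f s) * (\<integral>t. \<kappa> t s * (indicator {a..b} t * g t) \<partial>lborel) \<partial>lborel)"
  proof (rule Fubini_bounded_kernel[OF _ _ _ _ _ _ A _ B])
    have "(\<lambda>p. indicator E p * (case p of (t, s) \<Rightarrow> indicator ({a..b} \<times> {a..b}) (t, s) * k t s))
        \<in> borel_measurable (lborel \<Otimes>\<^sub>M lborel)"
      using E(1) k by (intro borel_measurable_times borel_measurable_indicator)
    also have "(\<lambda>p. indicator E p * (case p of (t, s) \<Rightarrow> indicator ({a..b} \<times> {a..b}) (t, s) * k t s))
        = (\<lambda>(t, s). \<kappa> t s)"
      using E(2) by (auto simp: \<kappa>_def indicator_def fun_eq_iff)
    finally show "(\<lambda>(t, s). \<kappa> t s) \<in> borel_measurable (lborel \<Otimes>\<^sub>M lborel)" .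
    show "0 \<le> \<kappa> t s" for t s using nonneg E(2) by (auto simp: \<kappa>_def indicator_def)
    show "\<kappa> t s = 0" if "t \<notin> {a..b}" for t s using that E(2) by (auto simp: \<kappa>_def indicator_def)
    show "integrable lborel (\<kappa> t)" if "t \<in> {a..b}" for t
      using int[OF that] by (simp add: \<kappa>_def[abs_def] set_integrable_def E')
    show "(\<integral>s. \<kappa> t s \<partial>lborel) \<le> C" if "t \<in> {a..b}" for t
      using bound[OF that] by (simp add: \<kappa>_def set_lebesgue_integral_def E')
  qed (use ext[OF g] ext[OF f] in auto)
  also have "(\<lambda>t. (indicator {a..b} t * g t) * (\<integral>s. \<kappa> t s * (indicator {a..b} s * f s) \<partial>lborel)) =
      (\<lambda>t. indicator {a..b} t * (g t * (LBINT s:{s. (t, s) \<in> E}. k t s * f s)))"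
  proof
    fix t
    have "(\<integral>s. \<kappa> t s * (indicator {a..b} s * f s) \<partial>lborel) = (LBINT s:{s. (t, s) \<in> E}. k t s * f s)"
      unfolding set_lebesgue_integral_def
      by (rule Bochner_Integration.integral_cong) (use E(2) in \<open>auto simp: \<kappa>_def indicator_def\<close>)
    then show "(indicator {a..b} t * g t) * (\<integral>s. \<kappa> t s * (indicator {a..b} s * f s) \<partial>lborel) =
      indicator {a..b} t * (g t * (LBINT s:{s. (t, s) \<in> E}. k t s * f s))" by simp
  qed
  also have "(\<lambda>s. (indicator {a..b} s * f s) * (\<integral>t. \<kappa> t s * (indicator {a..b} t * g t) \<partial>lborel)) =
      (\<lambda>s. indicator {a..b} s * (f s * (LBINT t:{t. (t, s) \<in> E}. k t s * g t)))"
  proof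
    fix s
    have "(\<integral>t. \<kappa> t s * (indicator {a..b} t * g t) \<partial>lborel) = (LBINT t:{t. (t, s) \<in> E}. k t s * g t)"
      unfolding set_lebesgue_integral_def
      by (rule Bochner_Integration.integral_cong) (use E(2) in \<open>auto simp: \<kappa>_def indicator_def\<close>)
    then show "(indicator {a..b} s * f s) * (\<integral>t. \<kappa> t s * (indicator {a..b} t * g t) \<partial>lborel) =
      indicator {a..b} s * (f s * (LBINT t:{t. (t, s) \<in> E}. k t s * g t))" by simp
  qed
  finally show ?thesis by (simp add: set_lebesgue_integral_def)
qed

text \<open>The region is the triangle \<open>s \<le> t \<le> T\<close>. For \<open>s > T\<close>
  the interval \<open>{s..T}\<close> is empty, so the outer integral on the right may run over all
  of \<open>[a,b]\<close>.\<close>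

lemma left_frac_kernel_swap:
  assumes ab: "a < b" and T: "T \<in> {a..b}"
    and \<alpha>: "variable_order a b \<alpha>" and wp: "Caputo_well_posed a b \<alpha> \<beta>"
    and g: "continuous_on {a..b} g" and f: "continuous_on {a..b} f"
  shows "(LBINT t:{a..T}. g t * (LBINT s:{a..t}. frac_kernel \<alpha> t s * f s)) =
         (LBINT s:{a..b}. f s * (LBINT t:{s..T}. frac_kernel \<alpha> t s * g t))"
proof -
  obtain C where C:
    "\<And>t. t \<in> {a..b} \<Longrightarrow> set_integrable lborel {a..t} (frac_kernel \<alpha> t)"
    "\<And>t. t \<in> {a..b} \<Longrightarrow> \<bar>LBINT s:{a..t}. frac_kernel \<alpha> t s\<bar> \<le> C"
    using frac_kernel_integral_bounded[OF ab wp] by metis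
  define E where "E = {(t, s). a \<le> s \<and> s \<le> t \<and> t \<le> T}"
  have sec: "{s. (t, s) \<in> E} = (if t \<le> T then {a..t} else {})" for t by (auto simp: E_def)
  have sec': "{t. (t, s) \<in> E} = {s..T}" if "s \<in> {a..b}" for s using that by (auto simp: E_def)
  have "{p::real\<times>real. a \<le> snd p \<and> snd p \<le> fst p \<and> fst p \<le> T} \<in> sets borel"
    by (intro borel_closed closed_Collect_conj closed_Collect_le continuous_intros)
  then have E: "E \<in> sets (lborel \<Otimes>\<^sub>M lborel)"
    unfolding lborel_prod sets_lborel by (simp add: E_def case_prod_unfold)
  \<comment> \<open>For \<open>t > T\<close> the section of \<open>E\<close> is empty and its
    integral is zero, so the bound has to be nonnegative as well.\<close>
  have C0: "0 \<le> C" using C(2)[of a] ab by auto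
  have "(LBINT t:{a..b}. g t * (LBINT s:{s. (t, s) \<in> E}. frac_kernel \<alpha> t s * f s)) =
         (LBINT s:{a..b}. f s * (LBINT t:{t. (t, s) \<in> E}. frac_kernel \<alpha> t s * g t))"
  proof (rule kernel_integral_swap[OF frac_kernel_measurable[OF \<alpha>] frac_kernel_nonneg[OF \<alpha>] E _ _ _ g f])
    show "E \<subseteq> {a..b} \<times> {a..b}" using T by (auto simp: E_def)
    show "set_integrable lborel {s. (t, s) \<in> E} (frac_kernel \<alpha> t)" if "t \<in> {a..b}" for t
      using C(1)[OF that] by (auto simp: sec set_integrable_def)
    show "(LBINT s:{s. (t, s) \<in> E}. frac_kernel \<alpha> t s) \<le> C" if "t \<in> {a..b}" for t
      using C(2)[OF that] C0 by (auto simp: sec LBINT_empty)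
  qed
  also have "(LBINT s:{a..b}. f s * (LBINT t:{t. (t, s) \<in> E}. frac_kernel \<alpha> t s * g t)) =
      (LBINT s:{a..b}. f s * (LBINT t:{s..T}. frac_kernel \<alpha> t s * g t))"
    by (intro set_lebesgue_integral_cong) (auto simp: sec')
  also have "(LBINT t:{a..b}. g t * (LBINT s:{s. (t, s) \<in> E}. frac_kernel \<alpha> t s * f s)) =
      (LBINT t:{a..T}. g t * (LBINT s:{a..t}. frac_kernel \<alpha> t s * f s))"
    unfolding set_lebesgue_integral_def[of _ "{a..b}"] set_lebesgue_integral_def[of _ "{a..T}"]
    by (rule Bochner_Integration.integral_cong) (use T in \<open>auto simp: sec indicator_def LBINT_empty\<close>)
  finally show ?thesis .
qed

text \<open>The right operator at \<open>t \<le> T\<close> sees \<open>f\<close> up to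
  \<open>b\<close>, so the region is a trapezoid reaching beyond \<open>T\<close>, with sections
  \<open>{a..min s T}\<close>. The part \<open>s > T\<close> is the origin of the conditions on
  \<open>[T,b]\<close>.\<close>

lemma right_frac_kernel_swap:
  assumes ab: "a < b" and T: "T \<in> {a..b}"
    and \<beta>: "variable_order a b \<beta>" and wp: "Caputo_well_posed a b \<alpha> \<beta>"
    and g: "continuous_on {a..b} g" and f: "continuous_on {a..b} f"
  shows "(LBINT t:{a..T}. g t * (LBINT s:{t..b}. frac_kernel \<beta> s t * f s)) =
         (LBINT s:{a..b}. f s * (LBINT t:{a..min s T}. frac_kernel \<beta> s t * g t))"
proof -
  obtain C where C:
    "\<And>t. t \<in> {a..b} \<Longrightarrow> set_integrable lborel {t..b} (\<lambda>s. frac_kernel \<beta> s t)"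
    "\<And>t. t \<in> {a..b} \<Longrightarrow> \<bar>LBINT s:{t..b}. frac_kernel \<beta> s t\<bar> \<le> C"
    using frac_kernel_integral_bounded[OF ab wp] by metis
  define E where "E = {(t, s). a \<le> t \<and> t \<le> s \<and> s \<le> b \<and> t \<le> T}"
  have sec: "{s. (t, s) \<in> E} = (if t \<le> T then {t..b} else {})" if "t \<in> {a..b}" for t
    using that by (auto simp: E_def)
  have sec': "{t. (t, s) \<in> E} = {a..min s T}" if "s \<in> {a..b}" for s using that by (auto simp: E_def)
  have "{p::real\<times>real. a \<le> fst p \<and> fst p \<le> snd p \<and> snd p \<le> b \<and> fst p \<le> T} \<in> sets borel"
    by (intro borel_closed closed_Collect_conj closed_Collect_le continuous_intros)
  then have E: "E \<in> sets (lborel \<Otimes>\<^sub>M lborel)"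
    unfolding lborel_prod sets_lborel by (simp add: E_def case_prod_unfold)
  have C0: "0 \<le> C" using C(2)[of a] ab by auto
  \<comment> \<open>The right kernel carries its arguments in the opposite order, so measurability
    is transferred by exchanging the coordinates.\<close>
  have "(\<lambda>(t, s). indicator ({a..b} \<times> {a..b}) (s, t) * frac_kernel \<beta> s t)
      \<in> borel_measurable (lborel \<Otimes>\<^sub>M lborel)"
    using measurable_pair_swap[OF frac_kernel_measurable[OF \<beta>]] by simp
  then have meas: "(\<lambda>(t, s). indicator ({a..b} \<times> {a..b}) (t, s) * frac_kernel \<beta> s t)
      \<in> borel_measurable (lborel \<Otimes>\<^sub>M lborel)"
    by (simp add: indicator_times mult.commute mult.left_commute)
  have "(LBINT t:{a..b}. g t * (LBINT s:{s. (t, s) \<in> E}. frac_kernel \<beta> s t * f s)) =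
         (LBINT s:{a..b}. f s * (LBINT t:{t. (t, s) \<in> E}. frac_kernel \<beta> s t * g t))"
  proof (rule kernel_integral_swap[OF meas _ E _ _ _ g f])
    show "0 \<le> frac_kernel \<beta> s t" if "t \<in> {a..b}" "s \<in> {a..b}" for t s
      using frac_kernel_nonneg[OF \<beta>] that by blast
    show "E \<subseteq> {a..b} \<times> {a..b}" using T by (auto simp: E_def)
    show "set_integrable lborel {s. (t, s) \<in> E} (\<lambda>s. frac_kernel \<beta> s t)" if "t \<in> {a..b}" for t
      using C(1)[OF that] by (auto simp: sec[OF that] set_integrable_def)
    show "(LBINT s:{s. (t, s) \<in> E}. frac_kernel \<beta> s t) \<le> C" if "t \<in> {a..b}" for t
      using C(2)[OF that] C0 by (auto simp: sec[OF that] LBINT_empty)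
  qed
  also have "(LBINT s:{a..b}. f s * (LBINT t:{t. (t, s) \<in> E}. frac_kernel \<beta> s t * g t)) =
      (LBINT s:{a..b}. f s * (LBINT t:{a..min s T}. frac_kernel \<beta> s t * g t))"
    by (intro set_lebesgue_integral_cong) (auto simp: sec')
  also have "(LBINT t:{a..b}. g t * (LBINT s:{s. (t, s) \<in> E}. frac_kernel \<beta> s t * f s)) =
      (LBINT t:{a..T}. g t * (LBINT s:{t..b}. frac_kernel \<beta> s t * f s))"
    unfolding set_lebesgue_integral_def[of _ "{a..b}"] set_lebesgue_integral_def[of _ "{a..T}"]
    by (rule Bochner_Integration.integral_cong) (use T in \<open>auto simp: sec indicator_def LBINT_empty\<close>)
  finally show ?thesis .
qed

section \<open>Variations of C^1 functions and of their combined Caputo derivatives\<close>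

lemma C1_onD:
  assumes "C1_on a b y" "t \<in> {a..b}"
  shows "(y has_vector_derivative vector_derivative y (at t within {a..b})) (at t within {a..b})"
  using assms unfolding C1_on_def
  by (metis differentiableI_vector has_real_derivative_iff_has_vector_derivative vector_derivative_works)

lemma C1_on_continuous:
  assumes "C1_on a b y"
  shows "continuous_on {a..b} y"
  using assms unfolding C1_on_def by (auto intro: DERIV_continuous_on)

lemma C1_on_add_mult:
  assumes "C1_on a b x" "C1_on a b h"
  shows "C1_on a b (\<lambda>t. x t + c * h t)"
proof -
  obtain x' h' where "\<And>t. t \<in> {a..b} \<Longrightarrow> (x has_real_derivative x' t) (at t within {a..b})"
    "continuous_on {a..b} x'"
    "\<And>t. t \<in> {a..b} \<Longrightarrow> (h has_real_derivative h' t) (at t within {a..b})" "continuous_on {a..b} h'"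
    using assms unfolding C1_on_def by blast
  then show ?thesis unfolding C1_on_def
    by (intro exI[of _ "\<lambda>t. x' t + c * h' t"])
      (intro conjI ballI DERIV_add DERIV_cmult continuous_intros; simp)
qed

text \<open>The integrals are total functions, so additivity needs integrability of both integrands;
  \<open>Caputo_well_posed\<close> supplies it for every C^1 function.\<close>

lemma combined_Caputo_add_mult:
  assumes ab: "a < b" and wp: "Caputo_well_posed a b \<alpha> \<beta>"
    and x: "C1_on a b x" and h: "C1_on a b h" and t: "t \<in> {a..b}"
  shows "combined_Caputo a b \<alpha> \<beta> \<gamma>1 \<gamma>2 (\<lambda>t. x t + c * h t) t =
    combined_Caputo a b \<alpha> \<beta> \<gamma>1 \<gamma>2 x t + c * combined_Caputo a b \<alpha> \<beta> \<gamma>1 \<gamma>2 h t"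
proof -
  let ?D = "\<lambda>y s. vector_derivative y (at s within {a..b})"
  have D: "?D (\<lambda>t. x t + c * h t) s = ?D x s + c * ?D h s" if "s \<in> {a..b}" for s
    using ab that
    by (intro vector_derivative_within_closed_interval has_vector_derivative_add
        has_vector_derivative_mult_right C1_onD x h)
  have lin: "(LBINT s:S. k s * ?D (\<lambda>t. x t + c * h t) s) =
      (LBINT s:S. k s * ?D x s) + c * (LBINT s:S. k s * ?D h s)"
    if S: "S \<subseteq> {a..b}" "S \<in> sets lborel"
      and xi: "set_integrable lborel S (\<lambda>s. k s * ?D x s)"
      and hi: "set_integrable lborel S (\<lambda>s. k s * ?D h s)" for S and k :: "real \<Rightarrow> real"
  proof -
    have "(LBINT s:S. k s * ?D (\<lambda>t. x t + c * h t) s) =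
        (LBINT s:S. k s * ?D x s + c * (k s * ?D h s))"
      using S D by (intro set_lebesgue_integral_cong) (auto simp: algebra_simps)
    also have "\<dots> = (LBINT s:S. k s * ?D x s) + (LBINT s:S. c * (k s * ?D h s))"
      using xi hi by (intro set_integral_add) (auto intro: set_integrable_mult_right)
    finally show ?thesis by simp
  qed
  have "left_Caputo \<alpha> a b (\<lambda>t. x t + c * h t) t = left_Caputo \<alpha> a b x t + c * left_Caputo \<alpha> a b h t"
    "right_Caputo \<beta> a b (\<lambda>t. x t + c * h t) t = right_Caputo \<beta> a b x t + c * right_Caputo \<beta> a b h t"
    using wp x h t unfolding Caputo_well_posed_def left_Caputo_exists_def right_Caputo_exists_def
      left_Caputo_def right_Caputo_def by (intro lin; auto)+
  then show ?thesis by (simp add: combined_Caputo_def algebra_simps)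
qed

lemma combined_Caputo_continuous:
  assumes "Caputo_well_posed a b \<alpha> \<beta>" "C1_on a b x"
  shows "continuous_on {a..b} (combined_Caputo a b \<alpha> \<beta> \<gamma>1 \<gamma>2 x)"
  using assms unfolding Caputo_well_posed_def combined_Caputo_def[abs_def]
  by (intro continuous_intros) auto

subsection \<open>Perturbation of the Herglotz equation\<close>

text \<open>Banach's fixed point theorem for the Picard operator on the closed ball of radius
  \<open>\<rho>\<close>. The bound \<open>B\<close> keeps the ball invariant and \<open>l\<close>
  makes the operator a contraction, both on the whole interval at once, and \<open>f\<close> is
  controlled only on that ball.\<close>

lemma small_Lipschitz_ivp:
  fixes f :: "real \<Rightarrow> real \<Rightarrow> real"
  assumes ab: "a \<le> b" and \<rho>: "0 \<le> \<rho>" and l: "0 \<le> l" "l * (b - a) < 1"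
    and B: "B * (b - a) \<le> \<rho>"
    and cont: "\<And>p. continuous_on {a..b} p \<Longrightarrow> (\<And>t. t \<in> {a..b} \<Longrightarrow> \<bar>p t\<bar> \<le> \<rho>) \<Longrightarrow>
                 continuous_on {a..b} (\<lambda>t. f t (p t))"
    and bound: "\<And>t u. t \<in> {a..b} \<Longrightarrow> \<bar>u\<bar> \<le> \<rho> \<Longrightarrow> \<bar>f t u\<bar> \<le> B"
    and lip: "\<And>t u v. t \<in> {a..b} \<Longrightarrow> \<bar>u\<bar> \<le> \<rho> \<Longrightarrow> \<bar>v\<bar> \<le> \<rho> \<Longrightarrow> \<bar>f t u - f t v\<bar> \<le> l * \<bar>u - v\<bar>"
  obtains p where "p a = 0" "\<And>t. t \<in> {a..b} \<Longrightarrow> \<bar>p t\<bar> \<le> \<rho>"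
    "\<And>t. t \<in> {a..b} \<Longrightarrow> (p has_real_derivative f t (p t)) (at t within {a..b})"
proof -
  \<comment> \<open>The complete space consists of bounded continuous functions on the whole line.
    The clamp \<open>c\<close> continues functions on \<open>[a,b]\<close> by constants to both
    sides.\<close>
  define c where "c t = max a (min t b)" for t :: real
  have c_in: "c t \<in> {a..b}" for t using ab by (auto simp: c_def)
  have c_id: "c t = t" if "t \<in> {a..b}" for t using that by (auto simp: c_def)
  have c_cont: "continuous_on UNIV c" unfolding c_def by (intro continuous_intros)
  define S :: "(real \<Rightarrow>\<^sub>C real) set" where "S = cball 0 \<rho>"
  have S_bd: "\<bar>apply_bcontfun u t\<bar> \<le> \<rho>" if "u \<in> S" for u t
    using norm_bounded[of u t] that by (simp add: S_def dist_norm)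
  define P where "P u t = integral {a..c t} (\<lambda>s. f s (apply_bcontfun u s))" for u t
  have fc: "continuous_on {a..b} (\<lambda>s. f s (apply_bcontfun u s))" if "u \<in> S" for u
    using S_bd[OF that] by (intro cont) auto
  have fi: "(\<lambda>s. f s (apply_bcontfun u s)) integrable_on {a..c t}" if "u \<in> S" for u t
    using integrable_continuous_real[OF continuous_on_subset[OF fc[OF that], of "{a..c t}"]] c_in[of t]
    by auto
  have B0: "0 \<le> B" using bound[of a 0] ab \<rho> by auto
  have P_bd: "\<bar>P u t\<bar> \<le> \<rho>" if "u \<in> S" for u t
  proof -
    have "norm (P u t) \<le> B * (c t - a)"
      unfolding P_def using c_in[of t] S_bd[OF that]
      by (intro integral_bound continuous_on_subset[OF fc[OF that]]) (auto intro!: bound)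
    also have "\<dots> \<le> B * (b - a)" using B0 c_in[of t] by (intro mult_left_mono) auto
    finally show ?thesis using B by simp
  qed
  have P_der: "((\<lambda>t. integral {a..t} (\<lambda>s. f s (apply_bcontfun u s))) has_real_derivative
      f t (apply_bcontfun u t)) (at t within {a..b})" if "u \<in> S" "t \<in> {a..b}" for u t
    using integral_has_real_derivative[OF fc[OF that(1)] that(2)] .
  have P_bc: "P u \<in> bcontfun" if "u \<in> S" for u
  proof (rule bcontfun_normI)
    have "continuous_on {a..b} (\<lambda>t. integral {a..t} (\<lambda>s. f s (apply_bcontfun u s)))"
      using P_der[OF that] by (rule DERIV_continuous_on)
    from continuous_on_compose2[OF this c_cont] c_in
    have "continuous_on UNIV (\<lambda>t. integral {a..c t} (\<lambda>s. f s (apply_bcontfun u s)))" by blast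
    then show "continuous_on UNIV (P u)" by (simp add: P_def[abs_def])
    show "norm (P u t) \<le> \<rho>" for t using P_bd[OF that] by simp
  qed
  define \<Phi> where "\<Phi> u = Bcontfun (P u)" for u
  have app: "apply_bcontfun (\<Phi> u) = P u" if "u \<in> S" for u
    unfolding \<Phi>_def using P_bc[OF that] by (rule Bcontfun_inverse)
  have "\<exists>!u\<in>S. \<Phi> u = u"
  proof (rule Banach_fix[of S "l * (b - a)"])
    show "complete S" unfolding S_def by (simp add: complete_eq_closed)
    show "S \<noteq> {}" using \<rho> by (auto simp: S_def intro!: exI[of _ 0])
    show "0 \<le> l * (b - a)" using l ab by simp
    show "l * (b - a) < 1" by fact
    show "\<Phi> ` S \<subseteq> S"
    proof safe
      fix u assume u: "u \<in> S"
      show "\<Phi> u \<in> S" using norm_bound[of "\<Phi> u" \<rho>] P_bd[OF u] app[OF u] by (simp add: S_def)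
    qed
    show "dist (\<Phi> u) (\<Phi> v) \<le> l * (b - a) * dist u v" if u: "u \<in> S" and v: "v \<in> S" for u v
    proof (rule dist_bound)
      fix t
      have "P u t - P v t = integral {a..c t} (\<lambda>s. f s (apply_bcontfun u s) - f s (apply_bcontfun v s))"
        unfolding P_def by (rule Henstock_Kurzweil_Integration.integral_diff[symmetric]) (intro fi u v)+
      also have "norm \<dots> \<le> (l * dist u v) * (c t - a)"
      proof (rule integral_bound)
        show "continuous_on {a..c t} (\<lambda>s. f s (apply_bcontfun u s) - f s (apply_bcontfun v s))"
          using c_in[of t] by (intro continuous_intros continuous_on_subset[OF fc] u v) auto
        fix s assume s: "s \<in> {a..c t}"
        have "norm (f s (apply_bcontfun u s) - f s (apply_bcontfun v s))
            \<le> l * \<bar>apply_bcontfun u s - apply_bcontfun v s\<bar>"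
          using lip[of s] s c_in[of t] S_bd[OF u] S_bd[OF v] by auto
        also have "\<dots> \<le> l * dist u v"
          using dist_bounded[of u s v] l by (intro mult_left_mono) (auto simp: dist_real_def)
        finally show "norm (f s (apply_bcontfun u s) - f s (apply_bcontfun v s)) \<le> l * dist u v" .
      qed (use c_in[of t] in auto)
      also have "\<dots> \<le> (l * dist u v) * (b - a)"
        using l c_in[of t] by (intro mult_left_mono) auto
      finally show "dist (apply_bcontfun (\<Phi> u) t) (apply_bcontfun (\<Phi> v) t) \<le> l * (b - a) * dist u v"
        by (simp add: app u v dist_norm mult_ac)
    qed
  qed
  then obtain u where u: "u \<in> S" "\<Phi> u = u" by blast
  have eq: "apply_bcontfun u t = P u t" for t using app[OF u(1)] u(2) by simp
  show thesis
  proof (rule that)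
    show "P u a = 0" using c_id[of a] ab by (simp add: P_def)
    show "\<bar>P u t\<bar> \<le> \<rho>" for t using P_bd[OF u(1)] .
    fix t assume t: "t \<in> {a..b}"
    from P_der[OF u(1) t] show "(P u has_real_derivative f t (P u t)) (at t within {a..b})"
      unfolding eq[symmetric, of t]
      by (rule has_field_derivative_transform_within[of _ _ _ _ 1])
        (use t c_id in \<open>auto simp: P_def\<close>)
  qed
qed

text \<open>Only the time is confined to \<open>[a,b]\<close>. The slices in the other arguments are
  full lines, so differentiability within the strip gives two-sided partial derivatives, also at
  \<open>t = a\<close> and \<open>t = b\<close>.\<close>

lemma partial_derivatives_eq:
  assumes L: "\<And>p. p \<in> {a..b} \<times> UNIV \<Longrightarrow>
      (L has_derivative blinfun_apply (L' p)) (at p within {a..b} \<times> UNIV)"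
    and t: "t \<in> {a..b}"
  shows "partial2 L (t, q) = L' (t, q) (0, 1, 0, 0)"
    and "partial3 L (t, q) = L' (t, q) (0, 0, 1, 0)"
    and "partial4 L (t, q) = L' (t, q) (0, 0, 0, 1)"
proof -
  obtain x v z where q: "q = (x, v, z)" by (metis prod.exhaust)
  \<comment> \<open>One chain rule along a line with direction \<open>e\<close> serves all three
    partial derivatives.\<close>
  have *: "deriv (\<lambda>s. L (t, c s)) s0 = L' (t, c s0) (0, e)"
    if c: "(c has_derivative (\<lambda>s. s *\<^sub>R e)) (at s0)" for c e and s0 :: real
  proof -
    have "((\<lambda>s. (t, c s)) has_derivative (\<lambda>s. (0, s *\<^sub>R e))) (at s0)"
      by (intro derivative_intros c)
    from has_derivative_in_compose2[OF L _ _ this] t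
    have "((\<lambda>s. L (t, c s)) has_derivative (\<lambda>s. L' (t, c s0) (0, s *\<^sub>R e))) (at s0)"
      by (simp add: image_subset_iff)
    moreover have "L' (t, c s0) (0, s *\<^sub>R e) = L' (t, c s0) (0, e) * s" for s
      using blinfun.scaleR_right[of "L' (t, c s0)" s "(0, e)"] by simp
    ultimately have "((\<lambda>s. L (t, c s)) has_real_derivative L' (t, c s0) (0, e)) (at s0)"
      by (simp add: has_field_derivative_def)
    then show ?thesis by (rule DERIV_imp_deriv)
  qed
  have "((\<lambda>s. (s, v, z)) has_derivative (\<lambda>s. s *\<^sub>R (1, 0, 0))) (at x)"
    by (auto intro!: derivative_eq_intros simp: fun_eq_iff zero_prod_def)
  from *[OF this] show "partial2 L (t, q) = L' (t, q) (0, 1, 0, 0)"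
    by (simp add: q partial2_def)
  have "((\<lambda>s. (x, s, z)) has_derivative (\<lambda>s. s *\<^sub>R (0, 1, 0))) (at v)"
    by (auto intro!: derivative_eq_intros simp: fun_eq_iff zero_prod_def)
  from *[OF this] show "partial3 L (t, q) = L' (t, q) (0, 0, 1, 0)"
    by (simp add: q partial3_def)
  have "((\<lambda>s. (x, v, s)) has_derivative (\<lambda>s. s *\<^sub>R (0, 0, 1))) (at z)"
    by (auto intro!: derivative_eq_intros simp: fun_eq_iff zero_prod_def)
  from *[OF this] show "partial4 L (t, q) = L' (t, q) (0, 0, 0, 1)"
    by (simp add: q partial4_def)
qed

text \<open>The derivative is uniformly continuous on a compact neighbourhood of the curve
  \<open>q\<close>, and the mean value inequality does the rest. The two-point form serves twice:
  \<open>w = 0\<close> bounds the linearization error, and general \<open>w\<close> bounds its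
  Lipschitz constant.\<close>

lemma uniform_linearization:
  fixes L :: "real \<times> 'a::euclidean_space \<Rightarrow> real"
  assumes L: "\<And>p. p \<in> {a..b} \<times> UNIV \<Longrightarrow>
      (L has_derivative blinfun_apply (L' p)) (at p within {a..b} \<times> UNIV)"
    and L'_cont: "continuous_on ({a..b} \<times> UNIV) L'"
    and q: "continuous_on {a..b} q" and \<eta>: "0 < \<eta>"
  obtains \<delta> where "0 < \<delta>"
    "\<And>t u w. t \<in> {a..b} \<Longrightarrow> norm u \<le> \<delta> \<Longrightarrow> norm w \<le> \<delta> \<Longrightarrow>
       \<bar>L (t, q t + u) - L (t, q t + w) - L' (t, q t) (0, u - w)\<bar> \<le> \<eta> * norm (u - w)"
proof -
  obtain R where R: "\<And>t. t \<in> {a..b} \<Longrightarrow> norm (q t) \<le> R"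
    using continuous_on_Icc_bounded[OF q] by blast
  \<comment> \<open>The radius \<open>R + 1\<close> leaves room for increments of norm at most
    \<open>\<delta> \<le> 1\<close>.\<close>
  define K where "K = {a..b} \<times> cball (0::'a) (R + 1)"
  have "uniformly_continuous_on K L'"
    unfolding K_def
    by (intro compact_uniformly_continuous continuous_on_subset[OF L'_cont] compact_Times) auto
  then obtain d where d: "0 < d"
    "\<And>p p'. p \<in> K \<Longrightarrow> p' \<in> K \<Longrightarrow> dist p' p < d \<Longrightarrow> dist (L' p') (L' p) < \<eta>"
    using \<eta> unfolding uniformly_continuous_on_def by meson
  define \<delta> where "\<delta> = min 1 (d / 2)"
  have \<delta>: "0 < \<delta>" "\<delta> \<le> 1" "\<delta> < d" using d(1) by (auto simp: \<delta>_def)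
  show thesis
  proof (rule that[OF \<delta>(1)])
    fix t and u w :: 'a assume t: "t \<in> {a..b}" and u: "norm u \<le> \<delta>" and w: "norm w \<le> \<delta>"
    define S where "S = {t} \<times> cball (q t) \<delta>"
    have S: "S \<subseteq> {a..b} \<times> UNIV" using t by (auto simp: S_def)
    have cvx: "convex S" unfolding S_def by (intro convex_Times) auto
    have uS: "(t, q t + u) \<in> S" and wS: "(t, q t + w) \<in> S" and qS: "(t, q t) \<in> S"
      using u w \<delta> by (auto simp: S_def dist_norm)
    have "norm (L (t, q t + u) - L (t, q t + w) - blinfun_apply (L' (t, q t)) ((t, q t + u) - (t, q t + w)))
        \<le> norm ((t, q t + u) - (t, q t + w)) * \<eta>"
    proof (rule differentiable_bound_linearization)
      show "(t, q t + w) + s *\<^sub>R ((t, q t + u) - (t, q t + w)) \<in> S" if "s \<in> {0..1}" for s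
        using convexD_alt[OF cvx wS uS, of s] that by (auto simp: algebra_simps)
      show "(L has_derivative blinfun_apply (L' p)) (at p within S)" if "p \<in> S" for p
        using L[of p] S that by (auto intro: has_derivative_subset)
      show "onorm (blinfun_apply (L' p) - blinfun_apply (L' (t, q t))) \<le> \<eta>" if pS: "p \<in> S" for p
      proof -
        obtain y where p: "p = (t, y)" and y: "dist (q t) y \<le> \<delta>" using pS by (auto simp: S_def)
        have "norm y \<le> norm (q t) + dist (q t) y"
          by (metis dist_norm norm_minus_commute norm_triangle_sub)
        then have "dist (L' p) (L' (t, q t)) < \<eta>"
          using R[OF t] y \<delta> t p by (intro d(2)) (auto simp: K_def dist_Pair_Pair dist_commute)
        moreover have "blinfun_apply (L' p) - blinfun_apply (L' (t, q t)) = blinfun_apply (L' p - L' (t, q t))"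
          by (auto simp: blinfun.diff_left)
        ultimately show ?thesis by (simp add: dist_norm norm_blinfun.rep_eq)
      qed
    qed (rule qS)
    then show "\<bar>L (t, q t + u) - L (t, q t + w) - L' (t, q t) (0, u - w)\<bar> \<le> \<eta> * norm (u - w)"
      by (simp add: norm_Pair mult.commute)
  qed
qed

lemma herglotz_perturbation:
  fixes L :: "real \<times> real \<times> real \<times> real \<Rightarrow> real"
  assumes ab: "a < b"
    and L: "\<And>p. p \<in> {a..b} \<times> UNIV \<Longrightarrow>
      (L has_derivative blinfun_apply (L' p)) (at p within {a..b} \<times> UNIV)"
    and L'_cont: "continuous_on ({a..b} \<times> UNIV) L'"
    and cont [continuous_intros]: "continuous_on {a..b} x" "continuous_on {a..b} v"
      "continuous_on {a..b} h" "continuous_on {a..b} k"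
    and z: "\<And>t. t \<in> {a..b} \<Longrightarrow> (z has_real_derivative L (t, x t, v t, z t)) (at t within {a..b})"
    and l2_def: "l2 = (\<lambda>t. L' (t, x t, v t, z t) (0, 1, 0, 0))"
    and l3_def: "l3 = (\<lambda>t. L' (t, x t, v t, z t) (0, 0, 1, 0))"
    and l4_def: "l4 = (\<lambda>t. L' (t, x t, v t, z t) (0, 0, 0, 1))"
    and lam_def: "lam = (\<lambda>t. exp (- integral {a..t} l4))"
    and Q_def: "Q = (\<lambda>t. integral {a..t} (\<lambda>s. lam s * (l2 s * h s + l3 s * k s)))"
    and \<rho>: "0 < \<rho>"
  obtains \<epsilon>0 where "0 < \<epsilon>0" "\<And>\<epsilon>. \<epsilon> \<noteq> 0 \<Longrightarrow> \<bar>\<epsilon>\<bar> < \<epsilon>0 \<Longrightarrow> \<exists>w. w a = z a \<and>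
      (\<forall>t\<in>{a..b}. (w has_real_derivative L (t, x t + \<epsilon> * h t, v t + \<epsilon> * k t, w t)) (at t within {a..b})) \<and>
      (\<forall>t\<in>{a..b}. \<bar>(w t - z t) * lam t / \<epsilon> - Q t\<bar> \<le> \<rho>)"
proof -
  txt \<open>With the ansatz \<open>w = z + \<epsilon> (Q + p) / lam\<close> the equation for \<open>w\<close> becomes \<open>p' = f t p\<close>, where \<open>f\<close>
    is the linearization error of \<open>L\<close>, divided by \<open>\<epsilon>\<close> and weighted by \<open>lam\<close>. It is uniformly small and
    has a small Lipschitz constant in \<open>p\<close>, so solutions exist on all of \<open>[a,b]\<close> although \<open>L\<close> is only
    locally Lipschitz.\<close>
  define q where "q = (\<lambda>t. (x t, v t, z t))"
  have [continuous_intros]: "continuous_on {a..b} z" using z by (rule DERIV_continuous_on)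
  have q_cont [continuous_intros]: "continuous_on {a..b} q"
    unfolding q_def by (intro continuous_intros)
  have tq_cont [continuous_intros]: "continuous_on {a..b} (\<lambda>t. L' (t, q t))"
    by (rule continuous_on_compose2[OF L'_cont]) (auto intro!: continuous_intros)
  have L_cont: "continuous_on ({a..b} \<times> UNIV) L"
    by (rule has_derivative_continuous_on) (rule L)
  have [continuous_intros]: "continuous_on {a..b} l2" "continuous_on {a..b} l3" "continuous_on {a..b} l4"
    using tq_cont unfolding l2_def l3_def l4_def q_def by (intro continuous_intros; assumption)+
  have lam_der: "(lam has_real_derivative - l4 t * lam t) (at t within {a..b})" if "t \<in> {a..b}" for t
    unfolding lam_def using that
    by (auto intro!: derivative_eq_intros integral_has_real_derivative continuous_intros)
  have [continuous_intros]: "continuous_on {a..b} lam" using lam_der by (rule DERIV_continuous_on)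
  have lam_pos: "0 < lam t" for t by (simp add: lam_def)
  have lam_nz [simp]: "lam t \<noteq> 0" for t using lam_pos[of t] by simp
  \<comment> \<open>The quotient \<open>Q / lam\<close> solves the linearized equation with initial
    value zero: \<open>lam\<close> is the integrating factor that absorbs the \<open>l4\<close>
    term.\<close>
  have Q_der: "(Q has_real_derivative lam t * (l2 t * h t + l3 t * k t)) (at t within {a..b})"
    if "t \<in> {a..b}" for t
    unfolding Q_def using that by (intro integral_has_real_derivative continuous_intros) auto
  have [continuous_intros]: "continuous_on {a..b} Q" using Q_der by (rule DERIV_continuous_on)
  obtain m where m: "0 < m" "\<And>t. t \<in> {a..b} \<Longrightarrow> \<bar>lam t\<bar> \<le> m"
    using continuous_on_Icc_bounded[OF \<open>continuous_on {a..b} lam\<close>] unfolding real_norm_def by blast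
  have "continuous_on {a..b} (\<lambda>t. \<bar>h t\<bar> + (\<bar>k t\<bar> + (\<bar>Q t\<bar> + \<rho>) / lam t))"
    by (intro continuous_intros) simp
  from continuous_on_Icc_bounded[OF this] obtain C where C: "0 < C"
    "\<And>t. t \<in> {a..b} \<Longrightarrow> norm (\<bar>h t\<bar> + (\<bar>k t\<bar> + (\<bar>Q t\<bar> + \<rho>) / lam t)) \<le> C" by blast
  \<comment> \<open>This is the increment of the last three arguments of \<open>L\<close> under the
    ansatz, divided by \<open>\<epsilon>\<close>. The constant \<open>C\<close> bounds it uniformly
    for \<open>p\<close> in the ball of radius \<open>\<rho>\<close>.\<close>
  define d where "d t p = (h t, k t, (Q t + p) / lam t)" for t p
  have d_bd: "norm (d t p) \<le> C" if "t \<in> {a..b}" "\<bar>p\<bar> \<le> \<rho>" for t p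
  proof -
    have "norm (d t p) \<le> \<bar>h t\<bar> + (\<bar>k t\<bar> + \<bar>(Q t + p) / lam t\<bar>)"
      unfolding d_def using norm_Pair_le[of "h t" "(k t, (Q t + p) / lam t)"]
        norm_Pair_le[of "k t" "(Q t + p) / lam t"] by simp
    also have "\<bar>(Q t + p) / lam t\<bar> \<le> (\<bar>Q t\<bar> + \<rho>) / lam t"
      using lam_pos[of t] that(2) by (auto simp: abs_mult intro!: divide_right_mono)
    finally show ?thesis using C(2)[OF that(1)] by simp
  qed
  have d_diff: "norm (d t p - d t p') = \<bar>p - p'\<bar> / lam t" for t p p'
    using lam_pos[of t] by (simp add: d_def norm_Pair flip: diff_divide_distrib)
  \<comment> \<open>The first entry makes the Picard operator preserve the ball of radius
    \<open>\<rho>\<close>; the second gives a contraction constant of at most 1/2.\<close>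
  define \<eta> where "\<eta> = min (\<rho> / (m * C * (b - a))) (1 / (2 * (b - a)))"
  have \<eta>: "0 < \<eta>" using \<rho> m C ab by (simp add: \<eta>_def)
  have \<eta>1: "m * \<eta> * C * (b - a) \<le> \<rho>"
  proof -
    have "\<eta> * (m * C * (b - a)) \<le> \<rho> / (m * C * (b - a)) * (m * C * (b - a))"
      using m C ab by (intro mult_right_mono) (auto simp: \<eta>_def)
    then show ?thesis using m C ab by (simp add: mult_ac)
  qed
  have \<eta>2: "\<eta> * (b - a) < 1"
  proof -
    have "\<eta> * (b - a) \<le> 1 / (2 * (b - a)) * (b - a)"
      using ab by (intro mult_right_mono) (auto simp: \<eta>_def)
    also have "\<dots> = 1 / 2" using ab by (simp add: divide_simps)
    finally show ?thesis by simp
  qed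
  obtain \<delta> where \<delta>: "0 < \<delta>" "\<And>t u w. t \<in> {a..b} \<Longrightarrow> norm u \<le> \<delta> \<Longrightarrow> norm w \<le> \<delta> \<Longrightarrow>
       \<bar>L (t, q t + u) - L (t, q t + w) - L' (t, q t) (0, u - w)\<bar> \<le> \<eta> * norm (u - w)"
    using uniform_linearization[OF L L'_cont q_cont \<eta>] by metis
  show thesis
  \<comment> \<open>For such \<open>\<epsilon>\<close> the actual increment
    \<open>\<epsilon> *\<^sub>R d t p\<close> has norm at most \<open>\<delta>\<close>, where the
    uniform linearization applies.\<close>
  proof (rule that[of "\<delta> / C"])
    show "0 < \<delta> / C" using \<delta> C by simp
    fix \<epsilon> :: real assume e0: "\<epsilon> \<noteq> 0" and e: "\<bar>\<epsilon>\<bar> < \<delta> / C"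
    have ed: "norm (\<epsilon> *\<^sub>R d t p) \<le> \<delta>" if "t \<in> {a..b}" "\<bar>p\<bar> \<le> \<rho>" for t p
    proof -
      have "\<bar>\<epsilon>\<bar> * norm (d t p) \<le> (\<delta> / C) * C"
        using e d_bd[OF that] \<delta>(1) C(1) by (intro mult_mono) auto
      then show ?thesis using C by simp
    qed
    have lin: "L' p (0, \<epsilon> *\<^sub>R u) = \<epsilon> * L' p (0, u)" for p u
      using blinfun.scaleR_right[of "L' p" \<epsilon> "(0, u)"] by simp
    define f where "f t p = lam t * ((L (t, q t + \<epsilon> *\<^sub>R d t p) - L (t, q t)) / \<epsilon> - L' (t, q t) (0, d t p))"
      for t p
    have f_diff: "f t p - f t p' = lam t / \<epsilon> *
        (L (t, q t + \<epsilon> *\<^sub>R d t p) - L (t, q t + \<epsilon> *\<^sub>R d t p') -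
         L' (t, q t) (0, \<epsilon> *\<^sub>R d t p - \<epsilon> *\<^sub>R d t p'))" for t p p'
    proof -
      have D: "L' (t, q t) (0, d t p - d t p') = L' (t, q t) (0, d t p) - L' (t, q t) (0, d t p')"
        using blinfun.diff_right[of "L' (t, q t)" "(0, d t p)" "(0, d t p')"] by simp
      show ?thesis
        unfolding scaleR_diff_right[symmetric] lin D f_def using e0 by (simp add: field_simps)
    qed
    have f_eq: "f t p = lam t / \<epsilon> *
        (L (t, q t + \<epsilon> *\<^sub>R d t p) - L (t, q t + 0) - L' (t, q t) (0, \<epsilon> *\<^sub>R d t p - 0))" for t p
      using e0 by (simp add: f_def lin field_simps)
    obtain p where p: "p a = 0" "\<And>t. t \<in> {a..b} \<Longrightarrow> \<bar>p t\<bar> \<le> \<rho>"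
      "\<And>t. t \<in> {a..b} \<Longrightarrow> (p has_real_derivative f t (p t)) (at t within {a..b})"
    proof (rule small_Lipschitz_ivp[of a b \<rho> \<eta> "m * \<eta> * C" f])
      show "a \<le> b" "0 \<le> \<rho>" "0 \<le> \<eta>" using ab \<rho> \<eta> by auto
      show "\<eta> * (b - a) < 1" "m * \<eta> * C * (b - a) \<le> \<rho>" by fact+
    next
      fix p :: "real \<Rightarrow> real" assume p [continuous_intros]: "continuous_on {a..b} p"
      have [continuous_intros]: "continuous_on {a..b} (\<lambda>t. d t (p t))"
        unfolding d_def by (intro continuous_intros) simp
      have "continuous_on {a..b} (\<lambda>t. L (t, q t + \<epsilon> *\<^sub>R d t (p t)))"
        "continuous_on {a..b} (\<lambda>t. L (t, q t))"
        by (rule continuous_on_compose2[OF L_cont]; auto intro!: continuous_intros)+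
      then show "continuous_on {a..b} (\<lambda>t. f t (p t))"
        unfolding f_def using e0 by (intro continuous_intros) auto
    next
      fix t p assume tp: "t \<in> {a..b}" "\<bar>p\<bar> \<le> \<rho>"
      have "\<bar>f t p\<bar> \<le> m / \<bar>\<epsilon>\<bar> * (\<eta> * norm (\<epsilon> *\<^sub>R d t p - 0))"
        unfolding f_eq abs_mult
        using \<delta>(2)[OF tp(1) ed[OF tp], of 0] \<delta>(1) m(1) m(2)[OF tp(1)]
        by (intro mult_mono) (auto simp: divide_right_mono)
      also have "\<dots> = m * \<eta> * norm (d t p)" using e0 by simp
      also have "\<dots> \<le> m * \<eta> * C" using d_bd[OF tp] m \<eta> by (intro mult_left_mono) auto
      finally show "\<bar>f t p\<bar> \<le> m * \<eta> * C" .
    next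
      fix t p p' assume tp: "t \<in> {a..b}" "\<bar>p\<bar> \<le> \<rho>" "\<bar>p'\<bar> \<le> \<rho>"
      have "\<bar>f t p - f t p'\<bar> \<le> \<bar>lam t / \<epsilon>\<bar> * (\<eta> * norm (\<epsilon> *\<^sub>R d t p - \<epsilon> *\<^sub>R d t p'))"
        unfolding f_diff abs_mult
        by (intro mult_left_mono \<delta>(2) ed tp) auto
      \<comment> \<open>The weight \<open>lam t\<close> cancels the denominator in \<open>d\<close>,
        and \<open>\<epsilon>\<close> cancels too, so the Lipschitz constant is the same for all
        \<open>\<epsilon>\<close>.\<close>
      also have "\<dots> = \<eta> * \<bar>p - p'\<bar>"
        using e0 lam_pos[of t] by (simp add: d_diff flip: scaleR_diff_right)
      finally show "\<bar>f t p - f t p'\<bar> \<le> \<eta> * \<bar>p - p'\<bar>" .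
    qed (rule that)
    define w where "w t = z t + \<epsilon> * ((Q t + p t) / lam t)" for t
    have "(w has_real_derivative L (t, x t + \<epsilon> * h t, v t + \<epsilon> * k t, w t)) (at t within {a..b})"
      if t: "t \<in> {a..b}" for t
    proof -
      have split: "L' (t, q t) (0, d t (p t)) = l2 t * h t + l3 t * k t + l4 t * ((Q t + p t) / lam t)"
      proof -
        have "(0, d t (p t)) = h t *\<^sub>R (0, 1, 0, 0) + k t *\<^sub>R (0, 0, 1, 0)
            + ((Q t + p t) / lam t) *\<^sub>R ((0::real), (0::real), (0::real), (1::real))"
          by (simp add: d_def)
        then show ?thesis
          by (simp only: blinfun.add_right blinfun.scaleR_right l2_def l3_def l4_def q_def)
            (simp add: mult.commute)
      qed
      have "(w has_real_derivative L (t, x t, v t, z t) + \<epsilon> *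
          (((lam t * (l2 t * h t + l3 t * k t) + f t (p t)) * lam t - (Q t + p t) * (- l4 t * lam t))
            / (lam t * lam t))) (at t within {a..b})"
        unfolding w_def
        by (intro DERIV_add DERIV_cmult DERIV_divide z Q_der p lam_der t lam_nz)
      \<comment> \<open>Differentiating \<open>1 / lam\<close> contributes the \<open>l4\<close>
        term that completes the linear part in \<open>split\<close>. This cancels the linear part
        subtracted in \<open>f\<close>, and only the increment of \<open>L\<close> is left.\<close>
      also have "L (t, x t, v t, z t) + \<epsilon> *
          (((lam t * (l2 t * h t + l3 t * k t) + f t (p t)) * lam t - (Q t + p t) * (- l4 t * lam t))
            / (lam t * lam t)) = L (t, q t + \<epsilon> *\<^sub>R d t (p t))"
        using e0 unfolding f_def split by (simp add: field_simps) (simp add: q_def)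
      also have "q t + \<epsilon> *\<^sub>R d t (p t) = (x t + \<epsilon> * h t, v t + \<epsilon> * k t, w t)"
        by (simp add: q_def d_def w_def)
      finally show ?thesis .
    qed
    moreover have "w a = z a" using p(1) by (simp add: w_def Q_def)
    moreover have "\<bar>(w t - z t) * lam t / \<epsilon> - Q t\<bar> \<le> \<rho>" if "t \<in> {a..b}" for t
      using p(2)[OF that] e0 by (simp add: w_def)
    ultimately show "\<exists>w. w a = z a \<and>
      (\<forall>t\<in>{a..b}. (w has_real_derivative L (t, x t + \<epsilon> * h t, v t + \<epsilon> * k t, w t)) (at t within {a..b})) \<and>
      (\<forall>t\<in>{a..b}. \<bar>(w t - z t) * lam t / \<epsilon> - Q t\<bar> \<le> \<rho>)" by blast
  qed
qed

subsection \<open>Necessary conditions\<close>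

lemma herglotz_partials_continuous:
  assumes L: "C1_lagrangian a b L" and wp: "Caputo_well_posed a b \<alpha> \<beta>"
    and adm: "herglotz_admissible L a b \<alpha> \<beta> \<gamma>1 \<gamma>2 xa za x z T"
    and xz_def: "xz = herglotz_arg a b \<alpha> \<beta> \<gamma>1 \<gamma>2 x z"
  shows "continuous_on {a..b} (\<lambda>t. partial2 L (xz t))"
    and "continuous_on {a..b} (\<lambda>t. partial3 L (xz t))"
    and "continuous_on {a..b} (\<lambda>t. partial4 L (xz t))"
proof -
  obtain L' where L': "\<And>p. p \<in> {a..b} \<times> UNIV \<Longrightarrow>
      (L has_derivative blinfun_apply (L' p)) (at p within {a..b} \<times> UNIV)"
    and L'_cont: "continuous_on ({a..b} \<times> UNIV) L'"
    using L unfolding C1_lagrangian_def by blast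
  have x: "C1_on a b x" and z: "continuous_on {a..b} z"
    using adm unfolding herglotz_admissible_def by (auto intro: DERIV_continuous_on)
  have "continuous_on {a..b} xz"
    unfolding xz_def herglotz_arg_def[abs_def]
    by (intro continuous_intros C1_on_continuous[OF x] z combined_Caputo_continuous[OF wp x])
  then have c: "continuous_on {a..b} (\<lambda>t. L' (xz t))"
    by (rule continuous_on_compose2[OF L'_cont]) (auto simp: xz_def herglotz_arg_def)
  have "continuous_on {a..b} (\<lambda>t. L' (xz t) e)" for e
    by (intro continuous_intros c)
  moreover have "partial2 L (xz t) = L' (xz t) (0, 1, 0, 0)" "partial3 L (xz t) = L' (xz t) (0, 0, 1, 0)"
    "partial4 L (xz t) = L' (xz t) (0, 0, 0, 1)" if "t \<in> {a..b}" for t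
    unfolding xz_def herglotz_arg_def using partial_derivatives_eq[OF L' that] by auto
  ultimately show "continuous_on {a..b} (\<lambda>t. partial2 L (xz t))"
    "continuous_on {a..b} (\<lambda>t. partial3 L (xz t))" "continuous_on {a..b} (\<lambda>t. partial4 L (xz t))"
    by (simp_all cong: continuous_on_cong_simp)
qed

lemma herglotz_lam_continuous:
  fixes l :: "real \<Rightarrow> real"
  assumes "continuous_on {a..b} l"
  shows "continuous_on {a..b} (\<lambda>t. exp (- (LBINT s:{a..t}. l s)))"
proof -
  have "continuous_on {a..b} (\<lambda>t. integral {a..t} l)"
    using integral_has_real_derivative[OF assms] by (rule DERIV_continuous_on)
  moreover have "(LBINT s:{a..t}. l s) = integral {a..t} l" if "t \<in> {a..b}" for t
    using that by (intro set_borel_integral_eq_integral borel_integrable_atLeastAtMost'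
        continuous_on_subset[OF assms]) auto
  ultimately have "continuous_on {a..b} (\<lambda>t. LBINT s:{a..t}. l s)"
    by (simp cong: continuous_on_cong_simp)
  then show ?thesis by (intro continuous_intros)
qed

text \<open>The time \<open>T\<close> is kept and \<open>x\<close> is varied in direction
  \<open>h\<close>. If the integral were nonzero, it would fix the sign of the difference quotient
  of \<open>z T\<close> for small \<open>\<epsilon>\<close>, so opposite signs of
  \<open>\<epsilon>\<close> would move \<open>z T\<close> both up and down, which excludes a minimum
  and a maximum alike.\<close>

lemma herglotz_first_variation:
  assumes ab: "a < b" and wp: "Caputo_well_posed a b \<alpha> \<beta>" and L: "C1_lagrangian a b L"
    and sol: "herglotz_solution L a b \<alpha> \<beta> \<gamma>1 \<gamma>2 xa za x z T"
    and xz_def: "xz = herglotz_arg a b \<alpha> \<beta> \<gamma>1 \<gamma>2 x z"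
    and lam_def: "lam = (\<lambda>t. exp (- (LBINT \<tau>:{a..t}. partial4 L (xz \<tau>))))"
    and h: "C1_on a b h" "h a = 0"
  shows "integral {a..T} (\<lambda>t. lam t * (partial2 L (xz t) * h t +
           partial3 L (xz t) * combined_Caputo a b \<alpha> \<beta> \<gamma>1 \<gamma>2 h t)) = 0"
proof -
  obtain L' where L': "\<And>p. p \<in> {a..b} \<times> UNIV \<Longrightarrow>
      (L has_derivative blinfun_apply (L' p)) (at p within {a..b} \<times> UNIV)"
    and L'_cont: "continuous_on ({a..b} \<times> UNIV) L'"
    using L unfolding C1_lagrangian_def by blast
  let ?C = "combined_Caputo a b \<alpha> \<beta> \<gamma>1 \<gamma>2"
  define v k where "v = ?C x" and "k = ?C h"
  have adm: "herglotz_admissible L a b \<alpha> \<beta> \<gamma>1 \<gamma>2 xa za x z T"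
    using sol by (simp add: herglotz_solution_def)
  then have x: "C1_on a b x" "x a = xa" "z a = za" and T: "T \<in> {a..b}"
    and z: "\<And>t. t \<in> {a..b} \<Longrightarrow> (z has_real_derivative L (t, x t, v t, z t)) (at t within {a..b})"
    by (auto simp: herglotz_admissible_def herglotz_arg_def v_def)
  have xz: "xz t = (t, x t, v t, z t)" for t by (simp add: xz_def herglotz_arg_def v_def)
  define l2 where "l2 = (\<lambda>t. L' (t, x t, v t, z t) (0, 1, 0, 0))"
  define l3 where "l3 = (\<lambda>t. L' (t, x t, v t, z t) (0, 0, 1, 0))"
  define l4 where "l4 = (\<lambda>t. L' (t, x t, v t, z t) (0, 0, 0, 1))"
  define la where "la = (\<lambda>t. exp (- integral {a..t} l4))"
  define Q where "Q = (\<lambda>t. integral {a..t} (\<lambda>s. la s * (l2 s * h s + l3 s * k s)))"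
  have p: "partial2 L (xz t) = l2 t" "partial3 L (xz t) = l3 t" "partial4 L (xz t) = l4 t"
    if "t \<in> {a..b}" for t
    using partial_derivatives_eq[OF L' that] by (auto simp: xz l2_def l3_def l4_def)
  \<comment> \<open>The Lebesgue integral in \<open>lam\<close> and the gauge integral in
    \<open>la\<close> agree because the integrand is continuous.\<close>
  have la: "lam t = la t" if t: "t \<in> {a..b}" for t
  proof -
    have "set_integrable lborel {a..t} (\<lambda>\<tau>. partial4 L (xz \<tau>))"
      using t by (intro borel_integrable_atLeastAtMost'
        continuous_on_subset[OF herglotz_partials_continuous(3)[OF L wp adm xz_def]]) auto
    then have "(LBINT \<tau>:{a..t}. partial4 L (xz \<tau>)) = integral {a..t} (\<lambda>\<tau>. partial4 L (xz \<tau>))"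
      by (rule set_borel_integral_eq_integral)
    also have "\<dots> = integral {a..t} l4"
      using t by (intro Henstock_Kurzweil_Integration.integral_cong p) auto
    finally show ?thesis by (simp add: lam_def la_def)
  qed
  have la_pos: "0 < la T" by (simp add: la_def)
  have "Q T = 0"
  proof (rule ccontr)
    assume Q: "Q T \<noteq> 0"
    \<comment> \<open>With an error of at most half of the absolute value of \<open>Q T\<close>, the
      weighted difference quotient keeps the sign of \<open>Q T\<close>.\<close>
    then have "0 < \<bar>Q T\<bar> / 2" by simp
    from herglotz_perturbation[OF ab L' L'_cont C1_on_continuous[OF x(1)] _ C1_on_continuous[OF h(1)] _
        z l2_def l3_def l4_def la_def Q_def this]
    obtain e0 where e0: "0 < e0" "\<And>\<epsilon>. \<epsilon> \<noteq> 0 \<Longrightarrow> \<bar>\<epsilon>\<bar> < e0 \<Longrightarrow> \<exists>w. w a = z a \<and>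
      (\<forall>t\<in>{a..b}. (w has_real_derivative L (t, x t + \<epsilon> * h t, v t + \<epsilon> * k t, w t)) (at t within {a..b})) \<and>
      (\<forall>t\<in>{a..b}. \<bar>(w t - z t) * la t / \<epsilon> - Q t\<bar> \<le> \<bar>Q T\<bar> / 2)"
      unfolding v_def k_def
      using combined_Caputo_continuous[OF wp x(1)] combined_Caputo_continuous[OF wp h(1)] by metis
    have ex: "\<exists>y w. herglotz_admissible L a b \<alpha> \<beta> \<gamma>1 \<gamma>2 xa za y w T \<and> 0 < (w T - z T) * s"
      if s: "s = 1 \<or> s = -1" for s :: real
    proof -
      \<comment> \<open>The factor \<open>sgn (Q T)\<close> compensates the sign of the variation,
        so that \<open>w T - z T\<close> gets the sign \<open>s\<close>.\<close>
      define \<epsilon> where "\<epsilon> = s * sgn (Q T) * (e0 / 2)"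
      have \<epsilon>: "\<epsilon> \<noteq> 0" "\<bar>\<epsilon>\<bar> < e0"
        using s e0(1) Q by (auto simp: \<epsilon>_def abs_mult abs_sgn_eq sgn_eq_0_iff)
      obtain w where w: "w a = z a"
        "\<And>t. t \<in> {a..b} \<Longrightarrow>
          (w has_real_derivative L (t, x t + \<epsilon> * h t, v t + \<epsilon> * k t, w t)) (at t within {a..b})"
        "\<bar>(w T - z T) * la T / \<epsilon> - Q T\<bar> \<le> \<bar>Q T\<bar> / 2"
        using e0(2)[OF \<epsilon>] T by blast
      have "?C (\<lambda>t. x t + \<epsilon> * h t) t = v t + \<epsilon> * k t" if "t \<in> {a..b}" for t
        unfolding v_def k_def by (rule combined_Caputo_add_mult[OF ab wp x(1) h(1) that])
      then have "herglotz_admissible L a b \<alpha> \<beta> \<gamma>1 \<gamma>2 xa za (\<lambda>t. x t + \<epsilon> * h t) w T"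
        using w(1,2) x T h by (auto simp: herglotz_admissible_def herglotz_arg_def C1_on_add_mult)
      moreover have "0 < (w T - z T) * s"
      proof -
        define u where "u = (w T - z T) * la T / \<epsilon>"
        have "0 < u * sgn (Q T)" using w(3) Q unfolding u_def[symmetric] by (auto simp: sgn_if abs_if split: if_splits)
        moreover have "(w T - z T) * s = u * sgn (Q T) * (e0 / 2 / la T)"
          using s \<epsilon>(1) Q la_pos e0(1) unfolding u_def \<epsilon>_def by (auto simp: sgn_if field_simps)
        ultimately show ?thesis using la_pos e0(1) by simp
      qed
      ultimately show ?thesis by blast
    qed
    obtain y w y' w' where "herglotz_admissible L a b \<alpha> \<beta> \<gamma>1 \<gamma>2 xa za y w T" "z T < w T"
      "herglotz_admissible L a b \<alpha> \<beta> \<gamma>1 \<gamma>2 xa za y' w' T" "w' T < z T"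
      using ex[of 1] ex[of "-1"] by auto
    then show False using sol unfolding herglotz_solution_def by force
  qed
  moreover have "integral {a..T} (\<lambda>t. lam t * (partial2 L (xz t) * h t + partial3 L (xz t) * ?C h t)) = Q T"
    unfolding Q_def k_def using T
    by (intro Henstock_Kurzweil_Integration.integral_cong) (auto simp: la p)
  ultimately show ?thesis by simp
qed

text \<open>Admissibility asks for the equation on all of \<open>[a,b]\<close>, so \<open>x\<close>
  and \<open>z\<close> stay admissible with any other final time. Hence \<open>z\<close> itself is
  extremal at \<open>T\<close>, and its derivative there is two-sided because \<open>T\<close> is
  interior.\<close>

lemma herglotz_terminal_time:
  assumes sol: "herglotz_solution L a b \<alpha> \<beta> \<gamma>1 \<gamma>2 xa za x z T" and T: "a < T" "T < b"
  shows "L (herglotz_arg a b \<alpha> \<beta> \<gamma>1 \<gamma>2 x z T) = 0"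
proof -
  let ?l = "L (herglotz_arg a b \<alpha> \<beta> \<gamma>1 \<gamma>2 x z T)"
  have adm: "herglotz_admissible L a b \<alpha> \<beta> \<gamma>1 \<gamma>2 xa za x z T"
    using sol by (simp add: herglotz_solution_def)
  then have adm': "herglotz_admissible L a b \<alpha> \<beta> \<gamma>1 \<gamma>2 xa za x z S" if "S \<in> {a..b}" for S
    using that by (simp add: herglotz_admissible_def)
  have "(z has_real_derivative ?l) (at T within {a..b})"
    using adm by (simp add: herglotz_admissible_def)
  then have der: "(z has_real_derivative ?l) (at T)"
    using T by (simp add: at_within_Icc_at)
  from sol consider "\<And>S. S \<in> {a..b} \<Longrightarrow> z T \<le> z S" | "\<And>S. S \<in> {a..b} \<Longrightarrow> z S \<le> z T"
    unfolding herglotz_solution_def using adm' by blast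
  then show ?thesis
  proof cases
    case 1
    show ?thesis
      by (rule DERIV_local_min[OF der, of "min (T - a) (b - T)"]) (use T 1 in \<open>auto simp: abs_if split: if_splits\<close>)
  next
    case 2
    show ?thesis
      by (rule DERIV_local_max[OF der, of "min (T - a) (b - T)"]) (use T 2 in \<open>auto simp: abs_if split: if_splits\<close>)
  qed
qed

text \<open>The condition \<open>a < T\<close> rules out a boundary extremum at \<open>a\<close>:
  for \<open>L = 1\<close> the minimum is attained at \<open>T = a\<close>, where \<open>L\<close>
  does not vanish. The guard \<open>T < b\<close> in the second equation is there because
  derivatives within a one-point interval are not determined.\<close>

theorem theorem3p1:
  fixes a b \<gamma>1 \<gamma>2 xa za T :: real
    and \<alpha> \<beta> :: "real \<Rightarrow> real \<Rightarrow> real"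
    and L :: "real \<times> real \<times> real \<times> real \<Rightarrow> real"
    and x z lam g :: "real \<Rightarrow> real"
    and xz :: "real \<Rightarrow> real \<times> real \<times> real \<times> real"
  assumes "a < b"
    and "variable_order a b \<alpha>" and "variable_order a b \<beta>"
    and "Caputo_well_posed a b \<alpha> \<beta>"
    and "\<gamma>1 \<in> {0..1}" and "\<gamma>2 \<in> {0..1}"
    and "C1_lagrangian a b L"
    and "herglotz_solution L a b \<alpha> \<beta> \<gamma>1 \<gamma>2 xa za x z T"
    and "a < T"
    and xz_def: "xz = herglotz_arg a b \<alpha> \<beta> \<gamma>1 \<gamma>2 x z"
    and lam_def: "lam = (\<lambda>t. exp (- (LBINT \<tau>:{a..t}. partial4 L (xz \<tau>))))"
    and g_def: "g = (\<lambda>t. lam t * partial3 L (xz t))"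
    and "left_RL_deriv_exists \<beta> T b g" and "continuous_on {T..b} (left_RL_deriv \<beta> T b g)"
    and "left_RL_deriv_exists \<beta> a b g" and "continuous_on {a..b} (left_RL_deriv \<beta> a b g)"
    and "right_RL_deriv_exists \<alpha> a T g"
    and "continuous_on {a..T} (dual_RL_deriv a b T \<alpha> \<beta> \<gamma>1 \<gamma>2 g)"
  shows "(\<forall>t\<in>{a..T}. partial2 L (xz t) * lam t + dual_RL_deriv a b T \<alpha> \<beta> \<gamma>1 \<gamma>2 g t = 0) \<and>
    (T < b \<longrightarrow> (\<forall>t\<in>{T..b}. \<gamma>2 * (left_RL_deriv \<beta> a b g t - left_RL_deriv \<beta> T b g t) = 0)) \<and>
    \<gamma>1 * right_RL_integral (\<lambda>s r. 1 - \<alpha> s r) T g T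
      - \<gamma>2 * left_RL_integral (\<lambda>s r. 1 - \<beta> s r) T g T = 0 \<and>
    \<gamma>2 * (left_RL_integral (\<lambda>s r. 1 - \<beta> s r) T g b
      - left_RL_integral (\<lambda>s r. 1 - \<beta> s r) a g b) = 0 \<and>
    (T < b \<longrightarrow> L (xz T) = 0)"
proof -
  note wp = assms(4) and sol = assms(8) and L = assms(7)
  have adm: "herglotz_admissible L a b \<alpha> \<beta> \<gamma>1 \<gamma>2 xa za x z T"
    using sol by (simp add: herglotz_solution_def)
  then have T: "T \<in> {a..b}" by (simp add: herglotz_admissible_def)
  note partials [continuous_intros] = herglotz_partials_continuous[OF L wp adm xz_def]
  have lam_cont [continuous_intros]: "continuous_on {a..b} lam"
    unfolding lam_def by (intro herglotz_lam_continuous partials)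
  have g_cont [continuous_intros]: "continuous_on {a..b} g"
    unfolding g_def by (intro continuous_intros)
  define u where "u = (\<lambda>t. lam t * partial2 L (xz t))"
  have u_cont [continuous_intros]: "continuous_on {a..b} u"
    unfolding u_def by (intro continuous_intros)
  have sub: "{a..T} \<subseteq> {a..b}" "{T..b} \<subseteq> {a..b}" using T by auto

  define \<Lambda> where "\<Lambda> s = integral {s..T} u" for s
  define K where "K s = (LBINT t:{s..T}. frac_kernel \<alpha> t s * g t)" for s
  \<comment> \<open>\<open>J c\<close> is the function differentiated in
    \<open>left_RL_deriv \<beta> c b g\<close>. The function \<open>H\<close> equals
    \<open>J a\<close> on \<open>[a,T]\<close> and \<open>J a - J T\<close> on
    \<open>[T,b]\<close>.\<close>
  define J where "J c s = (LBINT t:{c..s}. frac_kernel \<beta> s t * g t)" for c s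
  define H where "H s = (LBINT t:{a..min s T}. frac_kernel \<beta> s t * g t)" for s
  define M where "M s = \<Lambda> s + \<gamma>1 * K s - \<gamma>2 * H s" for s

  have \<Lambda>_der: "(\<Lambda> has_real_derivative - u t) (at t within {a..T})" if "t \<in> {a..T}" for t
    unfolding \<Lambda>_def using that sub
    by (intro integral_has_real_derivative' continuous_on_subset[OF u_cont]) auto
  have K_der: "(K has_real_derivative - right_RL_deriv \<alpha> a T g t) (at t within {a..T})"
    if "t \<in> {a..T}" for t
  proof -
    have K: "K s = - (LBINT \<tau>:{s..T}. - frac_kernel \<alpha> \<tau> s * g \<tau>)" for s
      by (simp add: K_def set_lebesgue_integral_def)
    have "((\<lambda>s. LBINT \<tau>:{s..T}. - frac_kernel \<alpha> \<tau> s * g \<tau>) has_real_derivative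
        right_RL_deriv \<alpha> a T g t) (at t within {a..T})"
      using \<open>right_RL_deriv_exists \<alpha> a T g\<close> that
      unfolding right_RL_deriv_exists_def right_RL_deriv_def has_real_derivative_iff_has_vector_derivative
      by (auto simp: vector_derivative_works)
    from DERIV_minus[OF this] show ?thesis by (simp add: K[abs_def])
  qed
  have J_der: "(J c has_real_derivative left_RL_deriv \<beta> c b g t) (at t within {c..b})"
    if "left_RL_deriv_exists \<beta> c b g" "t \<in> {c..b}" for c t
    using that
    unfolding left_RL_deriv_exists_def left_RL_deriv_def has_real_derivative_iff_has_vector_derivative
      J_def[abs_def] by (auto simp: vector_derivative_works)
  note Ja_der = J_der[OF \<open>left_RL_deriv_exists \<beta> a b g\<close>]
  note JT_der = J_der[OF \<open>left_RL_deriv_exists \<beta> T b g\<close>]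

  have \<Lambda>_0: "\<Lambda> s = 0" if "T \<le> s" for s
    using that by (cases "T = s") (auto simp: \<Lambda>_def)
  have K_0: "K s = 0" if "T \<le> s" for s
    using that by (cases "T = s") (auto simp: K_def LBINT_singleton[simplified] LBINT_empty)
  have H_left: "H s = J a s" if "s \<le> T" for s using that by (simp add: H_def J_def min_absorb1)
  \<comment> \<open>Splitting the integral over \<open>[a,s]\<close> at \<open>T\<close> uses
    integrability up to \<open>s\<close>, which is part of the existence of the left derivative on
    \<open>[a,b]\<close>.\<close>
  have H_right: "H s = J a s - J T s" if s: "s \<in> {T..b}" for s
  proof -
    let ?f = "\<lambda>t. frac_kernel \<beta> s t * g t"
    have i: "set_integrable lborel {a..s} ?f"
      using \<open>left_RL_deriv_exists \<beta> a b g\<close> s T by (auto simp: left_RL_deriv_exists_def)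
    have i': "set_integrable lborel {a..T} ?f" "set_integrable lborel {T..s} ?f"
      using s T by (auto intro: set_integrable_subset[OF i])
    have "integral {a..T} ?f + integral {T..s} ?f = integral {a..s} ?f"
      using s T set_borel_integral_eq_integral(1)[OF i]
      by (intro Henstock_Kurzweil_Integration.integral_combine) auto
    then show ?thesis
      using s set_borel_integral_eq_integral(2)[OF i] set_borel_integral_eq_integral(2)[OF i'(1)]
        set_borel_integral_eq_integral(2)[OF i'(2)]
      by (simp add: H_def J_def min_absorb2)
  qed

  have [continuous_intros]: "continuous_on {a..b} \<Lambda>"
  proof (rule continuous_on_Icc_join[of a T])
    show "continuous_on {a..T} \<Lambda>" using \<Lambda>_der by (rule DERIV_continuous_on)
    show "continuous_on {T..b} \<Lambda>" by (simp add: \<Lambda>_0 cong: continuous_on_cong_simp)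
  qed (use T in auto)
  \<comment> \<open>One-sided differentiability at \<open>T\<close> gives continuity from the left,
    and \<open>K T = 0\<close> matches the zero values beyond \<open>T\<close>.\<close>
  have [continuous_intros]: "continuous_on {a..b} K"
  proof (rule continuous_on_Icc_join[of a T])
    show "continuous_on {a..T} K" using K_der by (rule DERIV_continuous_on)
    show "continuous_on {T..b} K" by (simp add: K_0 cong: continuous_on_cong_simp)
  qed (use T in auto)
  have [continuous_intros]: "continuous_on {a..b} H"
  proof (rule continuous_on_Icc_join[of a T])
    have Ja: "continuous_on {a..b} (J a)" using Ja_der by (rule DERIV_continuous_on)
    have JT: "continuous_on {T..b} (J T)" using JT_der by (rule DERIV_continuous_on)
    show "continuous_on {a..T} H"
      using continuous_on_subset[OF Ja sub(1)] by (simp add: H_left cong: continuous_on_cong_simp)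
    show "continuous_on {T..b} H"
      using continuous_on_diff[OF continuous_on_subset[OF Ja sub(2)] JT]
      by (simp add: H_right cong: continuous_on_cong_simp)
  qed (use T in auto)
  have M_cont [continuous_intros]: "continuous_on {a..b} M"
    unfolding M_def by (intro continuous_intros)

  \<comment> \<open>The condition \<open>h a = 0\<close> preserves the initial value, and
    \<open>h b\<close> is free. The variation becomes the integral of the square of
    \<open>M\<close>, which forces \<open>M\<close> to be zero and not merely constant.\<close>
  define h where "h t = integral {a..t} M" for t
  have h_der: "(h has_real_derivative M t) (at t within {a..b})" if "t \<in> {a..b}" for t
    unfolding h_def using M_cont that by (rule integral_has_real_derivative)
  have h: "C1_on a b h" "h a = 0"
    unfolding C1_on_def using h_der M_cont by blast (simp add: h_def)
  have [continuous_intros]: "continuous_on {a..b} h" by (rule C1_on_continuous[OF h(1)])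
  have h': "vector_derivative h (at t within {a..b}) = M t" if "t \<in> {a..b}" for t
    using \<open>a < b\<close> that h_der[OF that]
    by (intro vector_derivative_within_closed_interval)
      (auto simp: has_real_derivative_iff_has_vector_derivative)
  define A where "A = left_Caputo \<alpha> a b h"
  define B where "B = right_Caputo \<beta> a b h"
  have [continuous_intros]: "continuous_on {a..b} A" "continuous_on {a..b} B"
    using wp h(1) by (auto simp: Caputo_well_posed_def A_def B_def)
  have A: "A t = (LBINT s:{a..t}. frac_kernel \<alpha> t s * M s)" if "t \<in> {a..b}" for t
    unfolding A_def left_Caputo_def using that
    by (intro set_lebesgue_integral_cong) (auto simp: h')
  have B: "B t = - (LBINT s:{t..b}. frac_kernel \<beta> s t * M s)" if "t \<in> {a..b}" for t
  proof -
    have "B t = (LBINT s:{t..b}. - (frac_kernel \<beta> s t * M s))"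
      unfolding B_def right_Caputo_def using that
      by (intro set_lebesgue_integral_cong) (auto simp: h')
    then show ?thesis by (simp add: set_lebesgue_integral_def)
  qed

  \<comment> \<open>Integration by parts. The boundary terms vanish by \<open>h a = 0\<close> and
    \<open>\<Lambda> T = 0\<close>, and the range extends to \<open>[a,b]\<close> because
    \<open>\<Lambda>\<close> is zero beyond \<open>T\<close>.\<close>
  have uh: "integral {a..T} (\<lambda>t. u t * h t) = integral {a..b} (\<lambda>s. M s * \<Lambda> s)"
  proof -
    have "((\<lambda>t. M t * \<Lambda> t - u t * h t) has_integral h T * \<Lambda> T - h a * \<Lambda> a) {a..T}"
    proof (rule fundamental_theorem_of_calculus)
      fix t assume t: "t \<in> {a..T}"
      then have "(h has_real_derivative M t) (at t within {a..T})"
        using h_der[of t] sub by (auto intro: DERIV_subset)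
      from DERIV_mult[OF this \<Lambda>_der[OF t]]
      show "((\<lambda>t. h t * \<Lambda> t) has_vector_derivative M t * \<Lambda> t - u t * h t) (at t within {a..T})"
        by (simp add: has_real_derivative_iff_has_vector_derivative)
    qed (use T in auto)
    then have "integral {a..T} (\<lambda>t. M t * \<Lambda> t - u t * h t) = 0"
      using \<Lambda>_0[of T] h(2) by (simp add: integral_unique)
    moreover have "integral {a..T} (\<lambda>t. M t * \<Lambda> t - u t * h t) =
        integral {a..T} (\<lambda>t. M t * \<Lambda> t) - integral {a..T} (\<lambda>t. u t * h t)"
      by (intro Henstock_Kurzweil_Integration.integral_diff integrable_continuous_real
        continuous_on_subset[OF _ sub(1)] continuous_intros)
    moreover have "integral {a..T} (\<lambda>t. M t * \<Lambda> t) + integral {T..b} (\<lambda>t. M t * \<Lambda> t) =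
        integral {a..b} (\<lambda>t. M t * \<Lambda> t)"
      using T by (intro Henstock_Kurzweil_Integration.integral_combine integrable_continuous_real
        continuous_intros) auto
    moreover have "integral {T..b} (\<lambda>t. M t * \<Lambda> t) = integral {T..b} (\<lambda>t. 0)"
      by (intro Henstock_Kurzweil_Integration.integral_cong) (simp add: \<Lambda>_0)
    ultimately show ?thesis by simp
  qed
  have gA: "integral {a..T} (\<lambda>t. g t * A t) = integral {a..b} (\<lambda>s. M s * K s)"
  proof -
    have "integral {a..T} (\<lambda>t. g t * A t) = (LBINT t:{a..T}. g t * A t)"
      by (intro LBINT_eq_integral[symmetric] continuous_on_subset[OF _ sub(1)] continuous_intros)
    also have "\<dots> = (LBINT t:{a..T}. g t * (LBINT s:{a..t}. frac_kernel \<alpha> t s * M s))"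
      using sub by (intro set_lebesgue_integral_cong) (auto simp: A)
    also have "\<dots> = (LBINT s:{a..b}. M s * K s)"
      unfolding K_def by (rule left_frac_kernel_swap[OF \<open>a < b\<close> T assms(2) wp g_cont M_cont])
    also have "\<dots> = integral {a..b} (\<lambda>s. M s * K s)"
      by (intro LBINT_eq_integral continuous_intros)
    finally show ?thesis .
  qed
  \<comment> \<open>The minus sign comes from the right Caputo derivative and accounts for the term
    \<open>- \<gamma>2 * H s\<close> in \<open>M\<close>.\<close>
  have gB: "integral {a..T} (\<lambda>t. g t * B t) = - integral {a..b} (\<lambda>s. M s * H s)"
  proof -
    have "integral {a..T} (\<lambda>t. g t * B t) = (LBINT t:{a..T}. g t * B t)"
      by (intro LBINT_eq_integral[symmetric] continuous_on_subset[OF _ sub(1)] continuous_intros)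
    also have "\<dots> = (LBINT t:{a..T}. - (g t * (LBINT s:{t..b}. frac_kernel \<beta> s t * M s)))"
      using sub by (intro set_lebesgue_integral_cong) (auto simp: B)
    also have "\<dots> = - (LBINT t:{a..T}. g t * (LBINT s:{t..b}. frac_kernel \<beta> s t * M s))"
      by (simp add: set_lebesgue_integral_def)
    also have "(LBINT t:{a..T}. g t * (LBINT s:{t..b}. frac_kernel \<beta> s t * M s)) =
        (LBINT s:{a..b}. M s * H s)"
      unfolding H_def by (rule right_frac_kernel_swap[OF \<open>a < b\<close> T assms(3) wp g_cont M_cont])
    also have "\<dots> = integral {a..b} (\<lambda>s. M s * H s)"
      by (intro LBINT_eq_integral continuous_intros)
    finally show ?thesis .
  qed

  have "integral {a..b} (\<lambda>s. M s * M s) = 0"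
  proof -
    have "0 = integral {a..T} (\<lambda>t. lam t * (partial2 L (xz t) * h t +
           partial3 L (xz t) * combined_Caputo a b \<alpha> \<beta> \<gamma>1 \<gamma>2 h t))"
      using herglotz_first_variation[OF \<open>a < b\<close> wp L sol xz_def lam_def h] by simp
    also have "\<dots> = integral {a..T} (\<lambda>t. u t * h t + \<gamma>1 * (g t * A t) + \<gamma>2 * (g t * B t))"
      by (intro Henstock_Kurzweil_Integration.integral_cong)
        (simp add: u_def g_def A_def B_def combined_Caputo_def algebra_simps)
    also have "\<dots> = integral {a..T} (\<lambda>t. u t * h t) + \<gamma>1 * integral {a..T} (\<lambda>t. g t * A t)
        + \<gamma>2 * integral {a..T} (\<lambda>t. g t * B t)"
    proof -
      have "(\<lambda>t. u t * h t) integrable_on {a..T}" "(\<lambda>t. g t * A t) integrable_on {a..T}"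
        "(\<lambda>t. g t * B t) integrable_on {a..T}"
        by (intro integrable_continuous_real continuous_on_subset[OF _ sub(1)] continuous_intros)+
      note this [THEN integrable_integral]
      from has_integral_add[OF has_integral_add[OF this(1) has_integral_mult_right[OF this(2)]]
          has_integral_mult_right[OF this(3)]]
      show ?thesis by (rule integral_unique)
    qed
    also have "\<dots> = integral {a..b} (\<lambda>s. M s * \<Lambda> s) + \<gamma>1 * integral {a..b} (\<lambda>s. M s * K s)
        - \<gamma>2 * integral {a..b} (\<lambda>s. M s * H s)"
      by (simp add: uh gA gB)
    also have "\<dots> = integral {a..b} (\<lambda>s. M s * \<Lambda> s + \<gamma>1 * (M s * K s) - \<gamma>2 * (M s * H s))"
    proof -
      have "(\<lambda>s. M s * \<Lambda> s) integrable_on {a..b}" "(\<lambda>s. M s * K s) integrable_on {a..b}"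
        "(\<lambda>s. M s * H s) integrable_on {a..b}"
        by (intro integrable_continuous_real continuous_intros)+
      note this [THEN integrable_integral]
      from has_integral_diff[OF has_integral_add[OF this(1) has_integral_mult_right[OF this(2)]]
          has_integral_mult_right[OF this(3)]]
      show ?thesis by (rule integral_unique[symmetric])
    qed
    also have "(\<lambda>s. M s * \<Lambda> s + \<gamma>1 * (M s * K s) - \<gamma>2 * (M s * H s)) = (\<lambda>s. M s * M s)"
      by (auto simp: M_def algebra_simps)
    finally show ?thesis by simp
  qed
  moreover have "continuous_on {a..b} (\<lambda>s. M s * M s)" by (intro continuous_intros)
  ultimately have M0: "M s = 0" if "s \<in> {a..b}" for s
    using integral_eq_0_iff[of a b "\<lambda>s. M s * M s"] \<open>a < b\<close> that by simp

  have "partial2 L (xz t) * lam t + dual_RL_deriv a b T \<alpha> \<beta> \<gamma>1 \<gamma>2 g t = 0" if t: "t \<in> {a..T}" for t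
  proof -
    have "(J a has_real_derivative left_RL_deriv \<beta> a b g t) (at t within {a..T})"
      using Ja_der[of t] t sub by (auto intro: DERIV_subset)
    then have "((\<lambda>s. \<Lambda> s + \<gamma>1 * K s - \<gamma>2 * J a s) has_real_derivative
        - u t + \<gamma>1 * - right_RL_deriv \<alpha> a T g t - \<gamma>2 * left_RL_deriv \<beta> a b g t) (at t within {a..T})"
      by (intro DERIV_diff DERIV_add DERIV_cmult \<Lambda>_der K_der t)
    moreover have "\<Lambda> s + \<gamma>1 * K s - \<gamma>2 * J a s = 0" if "s \<in> {a..T}" for s
      using M0[of s] that sub by (auto simp: M_def H_left)
    ultimately have "- u t + \<gamma>1 * - right_RL_deriv \<alpha> a T g t - \<gamma>2 * left_RL_deriv \<beta> a b g t = 0"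
      by (rule derivative_zero_on_Icc[OF \<open>a < T\<close> t])
    then show ?thesis by (simp add: u_def dual_RL_deriv_def mult.commute)
  qed
  moreover have "\<gamma>2 * (left_RL_deriv \<beta> a b g t - left_RL_deriv \<beta> T b g t) = 0"
    if "T < b" and t: "t \<in> {T..b}" for t
  proof -
    have "(J a has_real_derivative left_RL_deriv \<beta> a b g t) (at t within {T..b})"
      using Ja_der[of t] t sub by (auto intro: DERIV_subset)
    then have "((\<lambda>s. \<gamma>2 * (J a s - J T s)) has_real_derivative
        \<gamma>2 * (left_RL_deriv \<beta> a b g t - left_RL_deriv \<beta> T b g t)) (at t within {T..b})"
      by (intro DERIV_diff DERIV_cmult JT_der t)
    \<comment> \<open>Beyond \<open>T\<close> only the term with \<open>H\<close> is left in
      \<open>M\<close>.\<close>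
    moreover have "\<gamma>2 * (J a s - J T s) = 0" if "s \<in> {T..b}" for s
      using M0[of s] that sub by (auto simp: M_def H_right \<Lambda>_0 K_0)
    ultimately show ?thesis
      by (rule derivative_zero_on_Icc[OF \<open>T < b\<close> t])
  qed
  \<comment> \<open>Both integrals at \<open>T\<close> run over a single point, so this
    transversality condition holds term by term.\<close>
  moreover have "right_RL_integral (\<lambda>s r. 1 - \<alpha> s r) T g T = 0"
    "left_RL_integral (\<lambda>s r. 1 - \<beta> s r) T g T = 0"
    unfolding right_RL_integral_def left_RL_integral_def by (rule LBINT_singleton)+
  moreover have "\<gamma>2 * (left_RL_integral (\<lambda>s r. 1 - \<beta> s r) T g b
      - left_RL_integral (\<lambda>s r. 1 - \<beta> s r) a g b) = 0"
  proof -
    \<comment> \<open>For the order \<open>1 - \<beta>\<close> the exponent is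
      \<open>- \<beta>\<close>, so the integrand is the kernel of the derivative operators.\<close>
    have "left_RL_integral (\<lambda>s r. 1 - \<beta> s r) c g b = J c b" for c
      by (simp add: left_RL_integral_def J_def frac_kernel_def)
    then show ?thesis
      using M0[of b] T \<open>a < b\<close> by (auto simp: M_def H_right \<Lambda>_0 K_0)
  qed
  moreover have "L (xz T) = 0" if "T < b"
    unfolding xz_def by (rule herglotz_terminal_time[OF sol \<open>a < T\<close> that])
  ultimately show ?thesis by simp
qed

end
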